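(* For $n\ge1$ let $P_{n}^{(\mathrm{br},\mathrm{ipk})}(s,t)=\sum_{\pi\in\mathfrak{S}_{n}}s^{\mathrm{br}(\pi)}t^{\mathrm{ipk}(\pi)+1}$ and $P_{n}^{(\mathrm{br},\mathrm{ides})}(s,t)=\sum_{\pi\in\mathfrak{S}_{n}}s^{\mathrm{br}(\pi)}t^{\mathrm{ides}(\pi)+1}$. Then, as formal power series: (a) \begin{multline*} \frac{1}{(1-s)(1-t)}+\frac{2stx}{(1-s)^{2}(1-t)^{2}}+\frac{(1+s)^{3}}{8(1-s)}\sum_{n=2}^{\infty}\frac{(1+s^{2})^{n-1}(1+t)^{n+1}P_{n}^{(\mathrm{br},\mathrm{ipk})}\left(\frac{2s}{1+s^{2}},\frac{4t}{(1+t)^{2}}\right)}{(1-s^{2})^{n}(1-t)^{n+1}}x^{n}\\ =\sum_{i,j=0}^{\infty}\left(\frac{1+x}{1-x}\right)^{2ij}\left(1+s\left(\frac{1+x}{1-x}\right)^{j}\right)s^{2i}t^{j}; \end{multline*} (b) \begin{multline*} \frac{1}{(1-s)(1-t)}+\frac{stx}{(1-s)^{2}(1-t)^{2}}+\frac{(1+s)^{3}}{4(1-s)}\sum_{n=2}^{\infty}\frac{(1+s^{2})^{n-1}P_{n}^{(\mathrm{br},\mathrm{ides})}\left(\frac{2s}{1+s^{2}},t\right)}{(1-s^{2})^{n}(1-t)^{n+1}}x^{n}\\ =\frac{1}{2}\sum_{i,j=0}^{\infty}\left(\frac{1+x}{1-x}\right)^{ij}\left(2+\frac{s}{(1-x)^{j}}+s(1+x)^{j}\right)s^{2i}t^{j}.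 \end{multline*}
   Context: $\mathfrak{S}_n$ is the symmetric group on $[n]$. For $\pi\in\mathfrak{S}_n$: $i\in[n-1]$ is a descent if $\pi(i)>\pi(i+1)$, $\mathrm{des}(\pi)$ the number of descents, $\mathrm{ides}(\pi)=\mathrm{des}(\pi^{-1})$; $i$ with $2\le i\le n-1$ is a peak if $\pi(i-1)<\pi(i)>\pi(i+1)$, $\mathrm{pk}(\pi)$ the number of peaks, $\mathrm{ipk}(\pi)=\mathrm{pk}(\pi^{-1})$. A birun of $\pi$ (in one-line notation) is a maximal monotone (increasing or decreasing) consecutive subsequence, and $\mathrm{br}(\pi)$ is the number of biruns of $\pi$. *)

theory Defs
  imports
    "HOL-Combinatorics.Permutations"
    "HOL-Computational_Algebra.Formal_Power_Series"
begin

text \<open>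
  A permutation in \<open>\<SS>\<^sub>n\<close> is a function \<open>\<pi>\<close> with \<open>\<pi> permutes {1..n}\<close>; since \<open>\<pi>\<close> is then
  a function on all of \<^typ>\<open>nat\<close>, the statistics take \<open>n\<close> as an explicit argument.
\<close>

definition des :: "nat \<Rightarrow> (nat \<Rightarrow> nat) \<Rightarrow> nat" where
  "des n \<pi> = card {i. 1 \<le> i \<and> i < n \<and> \<pi> i > \<pi> (i + 1)}"

definition ides :: "nat \<Rightarrow> (nat \<Rightarrow> nat) \<Rightarrow> nat" where
  "ides n \<pi> = des n (inv \<pi>)"

definition pk :: "nat \<Rightarrow> (nat \<Rightarrow> nat) \<Rightarrow> nat" where
  "pk n \<pi> = card {i. 2 \<le> i \<and> i < n \<and> \<pi> (i - 1) < \<pi> i \<and> \<pi> i > \<pi> (i + 1)}"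

definition ipk :: "nat \<Rightarrow> (nat \<Rightarrow> nat) \<Rightarrow> nat" where
  "ipk n \<pi> = pk n (inv \<pi>)"

text \<open>
  The consecutive subsequence \<open>\<pi>(a) \<dots> \<pi>(b)\<close> is identified with the pair of positions \<open>(a, b)\<close>.
\<close>

definition monotone_segment :: "nat \<Rightarrow> (nat \<Rightarrow> nat) \<Rightarrow> nat \<Rightarrow> nat \<Rightarrow> bool" where
  "monotone_segment n \<pi> a b \<longleftrightarrow> 1 \<le> a \<and> a \<le> b \<and> b \<le> n \<and>
     (strict_mono_on {a..b} \<pi> \<or> strict_antimono_on {a..b} \<pi>)"

definition birun :: "nat \<Rightarrow> (nat \<Rightarrow> nat) \<Rightarrow> nat \<Rightarrow> nat \<Rightarrow> bool" where
  "birun n \<pi> a b \<longleftrightarrow> monotone_segment n \<pi> a b \<and>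
     (\<forall>a' b'. monotone_segment n \<pi> a' b' \<and> a' \<le> a \<and> b \<le> b' \<longrightarrow> a' = a \<and> b' = b)"

definition br :: "nat \<Rightarrow> (nat \<Rightarrow> nat) \<Rightarrow> nat" where
  "br n \<pi> = card {(a, b). birun n \<pi> a b}"

definition P_br_ipk :: "nat \<Rightarrow> 'a::comm_semiring_1 \<Rightarrow> 'a \<Rightarrow> 'a" where
  "P_br_ipk n s t = (\<Sum>\<pi> | \<pi> permutes {1..n}. s ^ br n \<pi> * t ^ (ipk n \<pi> + 1))"

definition P_br_ides :: "nat \<Rightarrow> 'a::comm_semiring_1 \<Rightarrow> 'a \<Rightarrow> 'a" where
  "P_br_ides n s t = (\<Sum>\<pi> | \<pi> permutes {1..n}. s ^ br n \<pi> * t ^ (ides n \<pi> + 1))"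

text \<open>
  The ring \<open>\<rat>[[s,t,x]]\<close> is represented as \<open>\<rat>[[s]][[t]][[x]]\<close>. The library division \<open>F / G\<close> on
  this iterated type is the true quotient whenever \<open>G\<close> has nonzero constant term in \<open>\<rat>\<close>.
\<close>

type_synonym fps3 = "rat fps fps fps"

definition var_s :: fps3 where "var_s = fps_const (fps_const fps_X)"
definition var_t :: fps3 where "var_t = fps_const fps_X"
definition var_x :: fps3 where "var_x = fps_X"

text \<open>The coefficient of \<open>s\<^sup>a t\<^sup>b x\<^sup>c\<close>.\<close>

definition coeff3 :: "fps3 \<Rightarrow> nat \<Rightarrow> nat \<Rightarrow> nat \<Rightarrow> rat" where
  "coeff3 F a b c = fps_nth (fps_nth (fps_nth F c) b) a"

lemma fps_mult_inverse_unit: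
  fixes G :: "'a::{comm_ring_1,inverse} fps"
  assumes "fps_nth G 0 * inverse (fps_nth G 0) = 1"
  shows "G * inverse G = 1"
  using fps_right_inverse[OF assms] by (simp add: fps_inverse_def)

lemma fps3_divide_mult:
  assumes "coeff3 G 0 0 0 \<noteq> 0"
  shows "F / G * G = F"
proof -
  have "fps_nth (fps_nth G 0) 0 * inverse (fps_nth (fps_nth G 0) 0) = 1"
    using assms by (intro fps_mult_inverse_unit) (simp add: coeff3_def)
  then have "G * inverse G = 1"
    by (rule fps_mult_inverse_unit[OF fps_mult_inverse_unit])
  moreover have "fps_nth G 0 \<noteq> 0"
    using assms by (auto simp: coeff3_def)
  then have "F / G = F * inverse G"
    by (simp add: fps_divide_def)
  ultimately show ?thesis
    by (simp add: mult.assoc mult.commute)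
qed

text \<open>
  Formal infinite sums: a family is summable if each monomial occurs in only finitely many
  members, and its sum is then taken coefficientwise. The library's metric on the iterated type
  only sees the order in the outermost variable, so it does not provide these sums.
\<close>

definition formal_summable :: "('i \<Rightarrow> fps3) \<Rightarrow> 'i set \<Rightarrow> bool" where
  "formal_summable f I \<longleftrightarrow> (\<forall>a b c. finite {i \<in> I. coeff3 (f i) a b c \<noteq> 0})"

definition formal_sum :: "('i \<Rightarrow> fps3) \<Rightarrow> 'i set \<Rightarrow> fps3" where
  "formal_sum f I =
     Abs_fps (\<lambda>c. Abs_fps (\<lambda>b. Abs_fps (\<lambda>a.
       \<Sum>i | i \<in> I \<and> coeff3 (f i) a b c \<noteq> 0. coeff3 (f i) a b c)))"

end

theory Submission
  imports Defs "HOL-Library.FuncSet"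
begin

text \<open>
  Fix a linearly ordered alphabet with signed letters and call a weakly increasing sequence
  \<open>f\<^sub>1 \<le> \<dots> \<le> f\<^sub>n\<close> compatible with \<open>\<sigma>\<close> if a positive letter is repeated only at ascents of
  \<open>\<sigma>\<close> and a negative one only at descents. Triples of a permutation \<open>\<pi>\<close>, a sequence compatible
  with \<open>\<pi>\<close> and a sequence compatible with \<open>\<pi>\<^sup>-\<^sup>1\<close> correspond to multisets of \<open>n\<close> pairs of letters in
  which only pairs of equal signs repeat: this is a Cauchy identity whose generating function is
  a product of factors \<open>1 / (1 - x)\<close> and \<open>1 + x\<close>.

  The remaining input is the generating function, in the size of the alphabet, of the number of
  sequences compatible with one fixed \<open>\<sigma>\<close>. All letters positive gives \<open>des\<close>. Alternating signs
  give the number of changes of direction of \<open>\<sigma>\<close>: adding up the two possible first signs gives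
  \<open>br\<close>, and restricting to alphabets of even size that start with a negative letter gives \<open>pk\<close>.
\<close>

unbundle fps_syntax

subsection \<open>Sequences compatible with a permutation\<close>

text \<open>\<open>P\<close> marks the positive letters. Values outside \<open>{1..n}\<close> are
  fixed, so that sequences can be counted and are equal once they agree on
  \<open>{1..n}\<close>.\<close>

definition compat :: "nat \<Rightarrow> (nat \<Rightarrow> nat) \<Rightarrow> (nat \<Rightarrow> bool) \<Rightarrow> nat \<Rightarrow> (nat \<Rightarrow> nat) set" where
  "compat n \<sigma> P m = {f \<in> {1..n} \<rightarrow>\<^sub>E {..<m}. \<forall>i. 1 \<le> i \<and> i < n \<longrightarrow>
     f i \<le> f (Suc i) \<and> (f i = f (Suc i) \<longrightarrow> (P (f i) \<longleftrightarrow> \<sigma> i < \<sigma> (Suc i)))}"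

lemma finite_compat: "finite (compat n \<sigma> P m)"
  by (rule finite_subset[of _ "{1..n} \<rightarrow>\<^sub>E {..<m}"]) (auto simp: compat_def intro: finite_PiE)

text \<open>The conditions on neighbours extend to distant positions: if a weakly increasing
  \<open>f\<close> takes one value at both ends, it is constant in between, and the sign of that
  letter makes \<open>\<sigma>\<close> go up at every step there or at none.\<close>

lemma compat_less:
  assumes f: "f \<in> compat n \<sigma> P m" and "1 \<le> i" "i < j" "j \<le> n"
  shows "f i \<le> f j" and "f i = f j \<Longrightarrow> P (f i) \<longleftrightarrow> \<sigma> i < \<sigma> j"
proof -
  have step: "f k \<le> f (Suc k) \<and> (f k = f (Suc k) \<longrightarrow> (P (f k) \<longleftrightarrow> \<sigma> k < \<sigma> (Suc k)))"
    if "1 \<le> k" "k < n" for k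
    using f that by (auto simp: compat_def)
  have "Suc i \<le> j" using assms by simp
  then have "j \<le> n \<longrightarrow> f i \<le> f j \<and> (f i = f j \<longrightarrow> (P (f i) \<longleftrightarrow> \<sigma> i < \<sigma> j))"
  proof (induction rule: dec_induct)
    case base
    show ?case using step[of i] \<open>1 \<le> i\<close> by simp
  next
    case (step k)
    note s = \<open>\<And>k. 1 \<le> k \<Longrightarrow> k < n \<Longrightarrow> _\<close>
    show ?case
      using step s[of k] \<open>1 \<le> i\<close> by fastforce
  qed
  then show "f i \<le> f j" and "f i = f j \<Longrightarrow> P (f i) \<longleftrightarrow> \<sigma> i < \<sigma> j"
    using \<open>j \<le> n\<close> by auto
qed

section \<open>Recursion on the last letter\<close>

text \<open>The number of compatible sequences of given length with last letter \<open>v\<close>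
  depends on the permutation only through its ascents: the previous letter is smaller, or it is
  \<open>v\<close> again if the sign allows it. Length 0 yields 0 because the empty sequence has no
  last letter; \<open>card_compat_id\<close> relies on this value.\<close>

fun ending_count :: "(nat \<Rightarrow> bool) \<Rightarrow> (nat \<Rightarrow> bool) \<Rightarrow> nat \<Rightarrow> nat \<Rightarrow> nat" where
  "ending_count asc P 0 v = 0"
| "ending_count asc P (Suc 0) v = 1"
| "ending_count asc P (Suc (Suc n)) v = (\<Sum>u<v. ending_count asc P (Suc n) u) +
     (if P v \<longleftrightarrow> asc (Suc n) then ending_count asc P (Suc n) v else 0)"

definition compat_ending :: "nat \<Rightarrow> (nat \<Rightarrow> nat) \<Rightarrow> (nat \<Rightarrow> bool) \<Rightarrow> nat \<Rightarrow> (nat \<Rightarrow> nat) set" where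
  "compat_ending n \<sigma> P v = {f \<in> compat n \<sigma> P (Suc v). f n = v}"

lemma compat_eq_UN_ending:
  assumes "1 \<le> n"
  shows "compat n \<sigma> P m = (\<Union>v<m. compat_ending n \<sigma> P v)"
proof (intro equalityI subsetI)
  fix f assume f: "f \<in> compat n \<sigma> P m"
  have "f i \<le> f n" if "i \<in> {1..n}" for i
    using compat_less(1)[OF f, of i n] that by (cases "i = n") auto
  then have "f \<in> compat_ending n \<sigma> P (f n)"
    using f unfolding compat_ending_def compat_def by (auto simp: PiE_iff less_Suc_eq_le)
  moreover have "f n < m"
    using f assms by (auto simp: compat_def PiE_iff)
  ultimately show "f \<in> (\<Union>v<m. compat_ending n \<sigma> P v)" by blast
next
  fix f assume "f \<in> (\<Union>v<m. compat_ending n \<sigma> P v)"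
  then obtain v where "v < m" and f: "f \<in> compat n \<sigma> P (Suc v)"
    by (auto simp: compat_ending_def)
  then have "{..<Suc v} \<subseteq> {..<m}" by auto
  then show "f \<in> compat n \<sigma> P m"
    using f PiE_mono[of "{1..n}" "\<lambda>_. {..<Suc v}" "\<lambda>_. {..<m}"] by (auto simp: compat_def)
qed

lemma finite_compat_ending: "finite (compat_ending n \<sigma> P v)"
  by (rule finite_subset[OF _ finite_compat[of n \<sigma> P "Suc v"]]) (auto simp: compat_ending_def)

lemma card_compat_eq_sum:
  assumes "1 \<le> n"
  shows "card (compat n \<sigma> P m) = (\<Sum>v<m. card (compat_ending n \<sigma> P v))"
  unfolding compat_eq_UN_ending[OF assms]
  by (rule card_UN_disjoint) (auto simp: finite_compat_ending, auto simp: compat_ending_def)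

text \<open>Deleting the last letter \<open>v\<close> leaves a sequence with all letters below
  \<open>v\<close> or one that ends in \<open>v\<close> itself; the latter needs the sign of
  \<open>v\<close> to fit the last step.\<close>

lemma compat_ending_Suc:
  assumes "1 \<le> n"
  shows "compat_ending (Suc n) \<sigma> P v = (\<lambda>f. f(Suc n := v)) `
    (compat n \<sigma> P v \<union> (if P v \<longleftrightarrow> \<sigma> n < \<sigma> (Suc n) then compat_ending n \<sigma> P v else {}))"
    (is "_ = ?h ` ?R")
proof (intro equalityI subsetI)
  fix f assume f: "f \<in> compat_ending (Suc n) \<sigma> P v"
  define g where "g = restrict f {1..n}"
  have fc: "f \<in> compat (Suc n) \<sigma> P (Suc v)" and fv: "f (Suc n) = v"
    using f by (auto simp: compat_ending_def)
  have "f = ?h g"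
    using fc fv by (auto simp: g_def compat_def PiE_iff extensional_def fun_eq_iff le_Suc_eq)
  moreover have gc: "g \<in> compat n \<sigma> P (Suc v)"
    using fc by (auto simp: g_def compat_def PiE_iff)
  moreover have gn: "g n = f n" using assms by (simp add: g_def)
  have "g \<in> ?R"
  proof (cases "f n = v")
    case True
    then show ?thesis
      using fc gc gn fv assms by (auto simp: compat_ending_def compat_def)
  next
    case False
    then have "f n < v" using compat_less(1)[OF fc, of n "Suc n"] fv assms by simp
    moreover have "f i \<le> f n" if "i \<in> {1..n}" for i
      using compat_less(1)[OF fc, of i n] that by (cases "i = n") auto
    ultimately have "g \<in> compat n \<sigma> P v"
      using gc by (fastforce simp: compat_def PiE_iff g_def)
    then show ?thesis by blast
  qed
  ultimately show "f \<in> ?h ` ?R" by blast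
next
  fix f assume "f \<in> ?h ` ?R"
  then obtain g where fg: "f = ?h g" and g: "g \<in> ?R" by blast
  have gc: "g \<in> compat n \<sigma> P (Suc v)"
    using g by (auto simp: compat_ending_def compat_def PiE_iff less_Suc_eq split: if_splits)
  have less: "g n < v" if "g \<in> compat n \<sigma> P v"
    using that assms by (auto simp: compat_def PiE_iff)
  have "g n \<le> v" and "g n = v \<longrightarrow> (P v \<longleftrightarrow> \<sigma> n < \<sigma> (Suc n))"
    using g less by (auto simp: compat_ending_def split: if_splits)
  then show "f \<in> compat_ending (Suc n) \<sigma> P v"
    using gc unfolding fg compat_ending_def compat_def
    by (auto simp: PiE_iff extensional_def less_Suc_eq)
qed

lemma inj_on_fun_upd_extensional: "a \<notin> A \<Longrightarrow> inj_on (\<lambda>f. f(a := v)) (extensional A)"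
proof (rule inj_onI)
  fix f g assume a: "a \<notin> A" "f \<in> extensional A" "g \<in> extensional A" "f(a := v) = g(a := v)"
  show "f = g"
  proof (rule extensionalityI[OF a(2,3)])
    fix x assume "x \<in> A"
    then show "f x = g x" using a(1) fun_cong[OF a(4), of x] by (cases "x = a") auto
  qed
qed

lemma card_compat_ending:
  "1 \<le> n \<Longrightarrow> card (compat_ending n \<sigma> P v) = ending_count (\<lambda>i. \<sigma> i < \<sigma> (Suc i)) P n v"
proof (induction n arbitrary: v rule: dec_induct)
  case base
  have "compat_ending 1 \<sigma> P v = {\<lambda>i. if i = 1 then v else undefined}"
    by (auto simp: compat_ending_def compat_def PiE_iff extensional_def fun_eq_iff)
  then show ?case by simp
next
  case (step n)
  let ?asc = "\<lambda>i. \<sigma> i < \<sigma> (Suc i)"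
  let ?T = "if P v \<longleftrightarrow> ?asc n then compat_ending n \<sigma> P v else {}"
  have "compat n \<sigma> P v \<union> ?T \<subseteq> extensional {1..n}"
    by (auto simp: compat_def compat_ending_def PiE_def)
  then have "inj_on (\<lambda>f. f(Suc n := v)) (compat n \<sigma> P v \<union> ?T)"
    by (rule inj_on_subset[OF inj_on_fun_upd_extensional, rotated]) simp
  then have "card (compat_ending (Suc n) \<sigma> P v) = card (compat n \<sigma> P v \<union> ?T)"
    by (simp add: compat_ending_Suc[OF step(1)] card_image)
  also have "\<dots> = card (compat n \<sigma> P v) + card ?T"
    using step(1) finite_compat_ending by (intro card_Un_disjoint finite_compat)
      (auto simp: compat_ending_def compat_def PiE_iff split: if_splits)
  also have "\<dots> = ending_count ?asc P (Suc n) v"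
    using step by (cases n) (auto simp: card_compat_eq_sum)
  finally show ?case .
qed

lemma card_compat:
  "1 \<le> n \<Longrightarrow> card (compat n \<sigma> P m) = (\<Sum>v<m. ending_count (\<lambda>i. \<sigma> i < \<sigma> (Suc i)) P n v)"
  by (simp add: card_compat_eq_sum card_compat_ending)

lemma card_compat_0 [simp]: "card (compat 0 \<sigma> P m) = 1"
proof -
  have "compat 0 \<sigma> P m = {\<lambda>_. undefined}" by (auto simp: compat_def)
  then show ?thesis by simp
qed

section \<open>Permutations recovered from sort keys\<close>

definition rank_perm :: "nat \<Rightarrow> (nat \<Rightarrow> nat) \<Rightarrow> nat \<Rightarrow> nat" where
  "rank_perm n key i = (if i \<in> {1..n} then card {j \<in> {1..n}. key j \<le> key i} else i)"

lemma rank_perm_less_iff: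
  assumes "i \<in> {1..n}" "j \<in> {1..n}"
  shows "rank_perm n key i < rank_perm n key j \<longleftrightarrow> key i < key j"
proof -
  have less: "rank_perm n key i < rank_perm n key j"
    if "key i < key j" "i \<in> {1..n}" "j \<in> {1..n}" for i j
  proof -
    have "{k \<in> {1..n}. key k \<le> key i} \<subset> {k \<in> {1..n}. key k \<le> key j}"
      (is "?A \<subset> ?B")
    proof
      show "?A \<subseteq> ?B" using that by auto
      have "j \<in> ?B" "j \<notin> ?A" using that by auto
      then show "?A \<noteq> ?B" by blast
    qed
    then have "card ?A < card ?B" by (rule psubset_card_mono[rotated]) simp
    then show ?thesis using that by (simp only: rank_perm_def if_True)
  qed
  have "rank_perm n key i = rank_perm n key j" if "key i = key j"
    using that assms by (simp add: rank_perm_def)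
  then show ?thesis
    using less[of i j] less[of j i] assms by (cases "key i" "key j" rule: linorder_cases) auto
qed

lemma rank_perm_permutes:
  assumes "inj_on key {1..n}"
  shows "rank_perm n key permutes {1..n}"
proof (rule bij_imp_permutes)
  have inj: "inj_on (rank_perm n key) {1..n}"
  proof (rule inj_onI)
    fix i j assume "i \<in> {1..n}" "j \<in> {1..n}" "rank_perm n key i = rank_perm n key j"
    then have "key i = key j"
      using rank_perm_less_iff[of i n j key] rank_perm_less_iff[of j n i key] by simp
    then show "i = j" using assms \<open>i \<in> _\<close> \<open>j \<in> _\<close> by (simp add: inj_on_eq_iff)
  qed
  have "rank_perm n key i \<in> {1..n}" if i: "i \<in> {1..n}" for i
  proof -
    have "card {j \<in> {1..n}. key j \<le> key i} \<le> card {1..n}" by (rule card_mono) auto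
    moreover have "card {j \<in> {1..n}. key j \<le> key i} > 0" using i by (auto simp: card_gt_0_iff)
    ultimately show ?thesis using i by (simp add: rank_perm_def)
  qed
  then show "bij_betw (rank_perm n key) {1..n} {1..n}"
    using inj by (simp add: bij_betw_def endo_inj_surj image_subset_iff)
qed (auto simp: rank_perm_def)

text \<open>A permutation is determined by the relative order of its values, since
  \<open>\<pi> i\<close> is the number of positions \<open>j\<close> with
  \<open>\<pi> j \<le> \<pi> i\<close>.\<close>

lemma rank_perm_unique:
  assumes \<pi>: "\<pi> permutes {1..n}"
    and iff: "\<And>i j. i \<in> {1..n} \<Longrightarrow> j \<in> {1..n} \<Longrightarrow> \<pi> i < \<pi> j \<longleftrightarrow> key i < key j"
  shows "\<pi> = rank_perm n key"
proof
  fix i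
  show "\<pi> i = rank_perm n key i"
  proof (cases "i \<in> {1..n}")
    case True
    have "key j \<le> key i \<longleftrightarrow> \<pi> j \<le> \<pi> i" if "j \<in> {1..n}" for j
      using iff[OF True that] by (simp add: not_less[symmetric])
    then have "card {j \<in> {1..n}. key j \<le> key i} = card {j \<in> {1..n}. \<pi> j \<le> \<pi> i}"
      by (intro arg_cong[where f = card]) auto
    also have "\<dots> = card (\<pi> ` {j \<in> {1..n}. \<pi> j \<le> \<pi> i})"
      using \<pi> by (intro card_image[symmetric] inj_on_subset[OF permutes_inj_on[of _ "{1..n}"]]) auto
    also have "\<pi> ` {j \<in> {1..n}. \<pi> j \<le> \<pi> i} = {k \<in> {1..n}. k \<le> \<pi> i}"
      by (subst (2) permutes_image[OF \<pi>, symmetric]) auto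
    also have "\<dots> = {1..\<pi> i}" using permutes_in_image[OF \<pi>, of i] True by auto
    finally show ?thesis using True by (simp add: rank_perm_def)
  next
    case False
    then show ?thesis using permutes_not_in[OF \<pi> False] by (auto simp: rank_perm_def)
  qed
qed

subsection \<open>The Cauchy identity\<close>

text \<open>
  A pair \<open>(b, a)\<close> of letters is coded as a number below \<open>k * p\<close>; for negative \<open>b\<close> the order of the
  second letters is reversed. Sequences of pairs that come from compatible triples are then exactly
  the increasing ones in which only pairs of equal signs repeat.
\<close>

definition pair_letter :: "(nat \<Rightarrow> bool) \<Rightarrow> nat \<Rightarrow> nat \<Rightarrow> nat \<Rightarrow> nat" where
  "pair_letter P p b a = b * p + (if P b then a else p - 1 - a)"

definition snd_letter :: "(nat \<Rightarrow> bool) \<Rightarrow> nat \<Rightarrow> nat \<Rightarrow> nat" where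
  "snd_letter P p v = (if P (v div p) then v mod p else p - 1 - v mod p)"

text \<open>These are the signs of the alphabet of pairs. Every step of \<open>id\<close> is an
  ascent, so in a sequence compatible with \<open>id\<close> exactly the positive letters may
  repeat.\<close>

definition signs_agree :: "(nat \<Rightarrow> bool) \<Rightarrow> (nat \<Rightarrow> bool) \<Rightarrow> nat \<Rightarrow> nat \<Rightarrow> bool" where
  "signs_agree P Q p v \<longleftrightarrow> (P (v div p) \<longleftrightarrow> Q (snd_letter P p v))"

lemma pair_letter_div [simp]: "a < p \<Longrightarrow> pair_letter P p b a div p = b"
  by (simp add: pair_letter_def)

lemma snd_pair_letter [simp]: "a < p \<Longrightarrow> snd_letter P p (pair_letter P p b a) = a"
proof -
  assume "a < p"
  then have "p - 1 - a < p" by simp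
  then have "(b * p + (p - 1 - a)) mod p = p - 1 - a" by (simp only: mod_mult_self3 mod_less)
  then show ?thesis
    using \<open>a < p\<close> pair_letter_div[OF \<open>a < p\<close>, of P b] by (simp only: snd_letter_def) (auto simp: pair_letter_def)
qed

lemma snd_letter_less [simp]: "0 < p \<Longrightarrow> snd_letter P p v < p"
  by (auto simp: snd_letter_def)

lemma pair_letter_collapse [simp]: "0 < p \<Longrightarrow> pair_letter P p (v div p) (snd_letter P p v) = v"
proof -
  assume "0 < p"
  then have "p - 1 - (p - 1 - v mod p) = v mod p" using mod_less_divisor[of p v] by linarith
  then show ?thesis by (auto simp only: pair_letter_def snd_letter_def if_True if_False div_mult_mod_eq split: if_split)
qed

lemma pair_letter_less: "a < p \<Longrightarrow> b < k \<Longrightarrow> pair_letter P p b a < k * p"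
proof -
  assume "a < p" "b < k"
  then have "pair_letter P p b a < Suc b * p" by (auto simp: pair_letter_def)
  also have "\<dots> \<le> k * p" using \<open>b < k\<close> by (intro mult_le_mono1) simp
  finally show ?thesis .
qed

lemma pair_letter_mono: "a < p \<Longrightarrow> b < b' \<Longrightarrow> pair_letter P p b a < pair_letter P p b' a'"
  using pair_letter_less[of a p b b' P] by (simp add: pair_letter_def)

text \<open>The inverse of the bijection recovers \<open>\<pi>\<close> as the standardization of the word \<open>w = g \<circ> \<pi>\<close>.\<close>

definition std_key :: "nat \<Rightarrow> (nat \<Rightarrow> bool) \<Rightarrow> (nat \<Rightarrow> nat) \<Rightarrow> nat \<Rightarrow> nat" where
  "std_key n Q w i = w i * Suc n + (if Q (w i) then i else n - i)"

lemma std_key_less_iff: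
  assumes "i \<in> {1..n}" "j \<in> {1..n}"
  shows "std_key n Q w i < std_key n Q w j \<longleftrightarrow>
    w i < w j \<or> w i = w j \<and> (if Q (w i) then i < j else j < i)"
proof -
  have less: "std_key n Q w i < std_key n Q w j" if "w i < w j" "i \<in> {1..n}" "j \<in> {1..n}" for i j
  proof -
    have "std_key n Q w i < Suc (w i) * Suc n" using that by (auto simp: std_key_def)
    also have "\<dots> \<le> w j * Suc n" using that by (intro mult_le_mono1) simp
    also have "\<dots> \<le> std_key n Q w j" by (simp add: std_key_def)
    finally show ?thesis .
  qed
  have eq: "std_key n Q w i < std_key n Q w j \<longleftrightarrow> (if Q (w i) then i < j else j < i)" if "w i = w j"
    using that assms by (auto simp: std_key_def)
  show ?thesis
    using less[of i j] less[of j i] eq assms by (cases "w i" "w j" rule: linorder_cases) auto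
qed

lemma inj_on_std_key: "inj_on (std_key n Q w) {1..n}"
proof (rule inj_onI)
  fix i j assume ij: "i \<in> {1..n}" "j \<in> {1..n}" "std_key n Q w i = std_key n Q w j"
  then have "\<not> std_key n Q w i < std_key n Q w j" "\<not> std_key n Q w j < std_key n Q w i" by simp_all
  then show "i = j"
    unfolding std_key_less_iff[OF ij(1,2)] std_key_less_iff[OF ij(2,1)]
    by (metis linorder_neqE_nat)
qed

text \<open>Since \<open>g\<close> is weakly increasing, a smaller value of \<open>\<pi>\<close>
  never has a larger letter. Between values with the same letter, compatibility with
  \<open>inv \<pi>\<close> orders their positions by the sign of the letter, which is the tie-break
  built into \<open>std_key\<close>.\<close>

lemma compat_inv_less_iff:
  assumes \<pi>: "\<pi> permutes {1..n}" and g: "g \<in> compat n (inv \<pi>) Q p"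
    and i: "i \<in> {1..n}" and j: "j \<in> {1..n}"
  shows "\<pi> i < \<pi> j \<longleftrightarrow> std_key n Q (g \<circ> \<pi>) i < std_key n Q (g \<circ> \<pi>) j"
proof -
  have less: "std_key n Q (g \<circ> \<pi>) i < std_key n Q (g \<circ> \<pi>) j"
    if "\<pi> i < \<pi> j" "i \<in> {1..n}" "j \<in> {1..n}" for i j
  proof -
    have "\<pi> i \<in> {1..n}" "\<pi> j \<in> {1..n}" using that by (simp_all only: permutes_in_image[OF \<pi>])
    then have "1 \<le> \<pi> i" "\<pi> j \<le> n" by auto
    note c = compat_less[OF g this(1) \<open>\<pi> i < \<pi> j\<close> this(2)]
    have "i \<noteq> j" using that by auto
    then show ?thesis
      using c that by (auto simp: std_key_less_iff permutes_inverses[OF \<pi>])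
  qed
  have "\<pi> i = \<pi> j \<longleftrightarrow> i = j" using permutes_inj[OF \<pi>] by (simp add: inj_eq)
  then show ?thesis
    using less[of i j] less[of j i] i j by (cases "\<pi> i" "\<pi> j" rule: linorder_cases) auto
qed

section \<open>The bijection between compatible triples and sequences of pairs\<close>

definition cauchy_map ::
    "nat \<Rightarrow> (nat \<Rightarrow> bool) \<Rightarrow> nat \<Rightarrow> (nat \<Rightarrow> nat) \<times> (nat \<Rightarrow> nat) \<times> (nat \<Rightarrow> nat) \<Rightarrow> nat \<Rightarrow> nat" where
  "cauchy_map n P p = (\<lambda>(\<pi>, f, g). \<lambda>i\<in>{1..n}. pair_letter P p (f i) (g (\<pi> i)))"

definition cauchy_triples ::
    "nat \<Rightarrow> (nat \<Rightarrow> bool) \<Rightarrow> nat \<Rightarrow> (nat \<Rightarrow> bool) \<Rightarrow> nat \<Rightarrow> ((nat \<Rightarrow> nat) \<times> (nat \<Rightarrow> nat) \<times> (nat \<Rightarrow> nat)) set" where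
  "cauchy_triples n P k Q p =
     (SIGMA \<pi>:{\<pi>. \<pi> permutes {1..n}}. compat n \<pi> P k \<times> compat n (inv \<pi>) Q p)"

text \<open>Where \<open>f\<close> stays on one letter, its sign says whether \<open>\<pi>\<close>
  goes up or down, hence by \<open>compat_inv_less_iff\<close> how the second letters move. The
  reversal in \<open>pair_letter\<close> turns both cases into an increase of the code. A repeated
  second letter moves \<open>\<pi>\<close> up iff it is positive, so a repeated pair has agreeing
  signs.\<close>

lemma cauchy_map_in_compat:
  assumes "(\<pi>, f, g) \<in> cauchy_triples n P k Q p"
  shows "cauchy_map n P p (\<pi>, f, g) \<in> compat n id (signs_agree P Q p) (k * p)"
proof -
  have \<pi>: "\<pi> permutes {1..n}" and f: "f \<in> compat n \<pi> P k" and g: "g \<in> compat n (inv \<pi>) Q p"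
    using assms by (auto simp: cauchy_triples_def)
  let ?w = "g \<circ> \<pi>"
  have fk: "f i < k" and w: "?w i < p" if "i \<in> {1..n}" for i
  proof -
    show "f i < k" using f that by (auto simp: compat_def PiE_iff)
    have "\<pi> i \<in> {1..n}" using that by (simp only: permutes_in_image[OF \<pi>])
    then show "?w i < p" using g by (auto simp: compat_def PiE_iff)
  qed
  have step: "pair_letter P p (f i) (?w i) \<le> pair_letter P p (f (Suc i)) (?w (Suc i)) \<and>
     (pair_letter P p (f i) (?w i) = pair_letter P p (f (Suc i)) (?w (Suc i)) \<longrightarrow>
        signs_agree P Q p (pair_letter P p (f i) (?w i)))" if "1 \<le> i" "i < n" for i
  proof -
    have i: "i \<in> {1..n}" "Suc i \<in> {1..n}" using that by auto
    note wi = w[OF i(1)] w[OF i(2)]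
    have fi: "f i \<le> f (Suc i)" and asc: "f i = f (Suc i) \<Longrightarrow> P (f i) \<longleftrightarrow> \<pi> i < \<pi> (Suc i)"
      using f that by (auto simp: compat_def)
    show ?thesis
    proof (cases "f i = f (Suc i)")
      case False
      then show ?thesis using pair_letter_mono[OF wi(1), of "f i" "f (Suc i)" P "?w (Suc i)"] fi by simp
    next
      case True
      have key: "P (f i) \<longleftrightarrow> std_key n Q ?w i < std_key n Q ?w (Suc i)"
        using asc[OF True] compat_inv_less_iff[OF \<pi> g i] by simp
      have "std_key n Q ?w i < std_key n Q ?w (Suc i) \<longleftrightarrow>
          ?w i < ?w (Suc i) \<or> ?w i = ?w (Suc i) \<and> Q (?w i)"
        unfolding std_key_less_iff[OF i] by simp
      then have key: "P (f i) \<longleftrightarrow> ?w i < ?w (Suc i) \<or> ?w i = ?w (Suc i) \<and> Q (?w i)"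
        using key by simp
      have agree: "signs_agree P Q p (pair_letter P p (f i) (?w i)) \<longleftrightarrow> (P (f i) \<longleftrightarrow> Q (?w i))"
        using wi by (simp add: signs_agree_def)
      show ?thesis
        using key wi unfolding agree unfolding True[symmetric] pair_letter_def
        by (cases "P (f i)"; cases "?w i = ?w (Suc i)") auto
    qed
  qed
  have "pair_letter P p (f i) (g (\<pi> i)) < k * p" if "i \<in> {1..n}" for i
    using pair_letter_less[OF w fk] that by simp
  then show ?thesis
    using step by (simp add: compat_def cauchy_map_def)
qed

text \<open>The codes determine \<open>f\<close> and the word \<open>g \<circ> \<pi>\<close>; the
  word determines \<open>\<pi>\<close> by standardization, and then \<open>g\<close> is the word
  read along \<open>inv \<pi>\<close>.\<close>

lemma inj_on_cauchy_map: "inj_on (cauchy_map n P p) (cauchy_triples n P k Q p)"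
proof (rule inj_onI)
  fix x y assume x: "x \<in> cauchy_triples n P k Q p" and y: "y \<in> cauchy_triples n P k Q p"
    and xy: "cauchy_map n P p x = cauchy_map n P p y"
  obtain \<pi> f g where x': "x = (\<pi>, f, g)" by (cases x)
  obtain \<pi>' f' g' where y': "y = (\<pi>', f', g')" by (cases y)
  have \<pi>: "\<pi> permutes {1..n}" and f: "f \<in> compat n \<pi> P k" and g: "g \<in> compat n (inv \<pi>) Q p"
    using x by (auto simp: cauchy_triples_def x')
  have \<pi>': "\<pi>' permutes {1..n}" and f': "f' \<in> compat n \<pi>' P k" and g': "g' \<in> compat n (inv \<pi>') Q p"
    using y by (auto simp: cauchy_triples_def y')
  have eq: "pair_letter P p (f i) (g (\<pi> i)) = pair_letter P p (f' i) (g' (\<pi>' i))" if "i \<in> {1..n}" for i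
    using fun_cong[OF xy, of i] that by (simp add: cauchy_map_def x' y')
  have gp: "g (\<pi> i) < p" "g' (\<pi>' i) < p" if "i \<in> {1..n}" for i
  proof -
    have "\<pi> i \<in> {1..n}" "\<pi>' i \<in> {1..n}"
      using that by (simp_all only: permutes_in_image[OF \<pi>] permutes_in_image[OF \<pi>'])
    then show "g (\<pi> i) < p" "g' (\<pi>' i) < p" using g g' by (auto simp: compat_def PiE_iff)
  qed
  have ff': "f i = f' i" if "i \<in> {1..n}" for i
    using arg_cong[OF eq[OF that], of "\<lambda>v. v div p"] gp[OF that] by simp
  have ww': "g (\<pi> i) = g' (\<pi>' i)" if "i \<in> {1..n}" for i
    using arg_cong[OF eq[OF that], of "snd_letter P p"] gp[OF that] by simp
  have "f = f'"
    using f f' ff' by (intro extensionalityI[of _ "{1..n}"]) (auto simp: compat_def PiE_iff)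
  have "\<pi> = rank_perm n (std_key n Q (g \<circ> \<pi>))"
    by (rule rank_perm_unique[OF \<pi> compat_inv_less_iff[OF \<pi> g]])
  also have "\<dots> = \<pi>'"
  proof (rule rank_perm_unique[OF \<pi>', symmetric])
    fix i j assume ij: "i \<in> {1..n}" "j \<in> {1..n}"
    show "\<pi>' i < \<pi>' j \<longleftrightarrow> std_key n Q (g \<circ> \<pi>) i < std_key n Q (g \<circ> \<pi>) j"
      using compat_inv_less_iff[OF \<pi>' g' ij] ww'[OF ij(1)] ww'[OF ij(2)] by (simp add: std_key_def)
  qed
  finally have "\<pi> = \<pi>'" .
  have "g = g'"
  proof (rule extensionalityI[of _ "{1..n}"])
    fix m assume "m \<in> {1..n}"
    then have "inv \<pi> m \<in> {1..n}" by (simp only: permutes_in_image[OF permutes_inv[OF \<pi>]])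
    from ww'[OF this] show "g m = g' m"
      unfolding \<open>\<pi> = \<pi>'\<close> by (simp add: permutes_inverses[OF \<pi>'])
  qed (use g g' in \<open>auto simp: compat_def PiE_iff\<close>)
  show "x = y" using \<open>\<pi> = \<pi>'\<close> \<open>f = f'\<close> \<open>g = g'\<close> x' y' by simp
qed

lemma cauchy_map_surj:
  assumes "0 < p" and h: "h \<in> compat n id (signs_agree P Q p) (k * p)"
  shows "h \<in> cauchy_map n P p ` cauchy_triples n P k Q p"
proof -
  define w where "w i = snd_letter P p (h i)" for i
  define \<pi> where "\<pi> = rank_perm n (std_key n Q w)"
  define f where "f = (\<lambda>i\<in>{1..n}. h i div p)"
  define g where "g = (\<lambda>i\<in>{1..n}. w (inv \<pi> i))"
  have \<pi>: "\<pi> permutes {1..n}" unfolding \<pi>_def by (rule rank_perm_permutes[OF inj_on_std_key])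
  have less_iff: "\<pi> i < \<pi> j \<longleftrightarrow> w i < w j \<or> w i = w j \<and> (if Q (w i) then i < j else j < i)"
    if "i \<in> {1..n}" "j \<in> {1..n}" for i j
    unfolding \<pi>_def rank_perm_less_iff[OF that] std_key_less_iff[OF that] ..
  have hk: "h i < k * p" if "i \<in> {1..n}" for i
    using h that by (auto simp: compat_def PiE_iff)
  have f: "f \<in> compat n \<pi> P k"
  proof -
    have "h i div p \<le> h (Suc i) div p \<and> (h i div p = h (Suc i) div p \<longrightarrow>
      (P (h i div p) \<longleftrightarrow> \<pi> i < \<pi> (Suc i)))" if "1 \<le> i" "i < n" for i
    proof -
      have i: "i \<in> {1..n}" "Suc i \<in> {1..n}" using that by auto
      have hi: "h i \<le> h (Suc i)" and agree: "h i = h (Suc i) \<Longrightarrow> signs_agree P Q p (h i)"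
        using h that by (auto simp: compat_def)
      have "P (h i div p) \<longleftrightarrow> \<pi> i < \<pi> (Suc i)" if d: "h i div p = h (Suc i) div p"
      proof -
        have iff: "\<pi> i < \<pi> (Suc i) \<longleftrightarrow> w i < w (Suc i) \<or> w i = w (Suc i) \<and> Q (w i)"
          unfolding less_iff[OF i] by simp
        show ?thesis
        proof (cases "h i = h (Suc i)")
          case True
          then show ?thesis using agree[OF True] unfolding iff by (simp add: signs_agree_def w_def)
        next
          case False
          have "h i = h i div p * p + h i mod p" "h (Suc i) = h (Suc i) div p * p + h (Suc i) mod p"
            by simp_all
          \<comment> \<open>Codes with equal quotient compare like their remainders, and
            \<open>snd_letter\<close> reverses the remainders exactly when the first letter is
            negative.\<close>
          then have "h i mod p < h (Suc i) mod p"
            using hi False d by (metis add_le_cancel_left le_neq_implies_less)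
          moreover have "h (Suc i) mod p < p" using \<open>0 < p\<close> by simp
          ultimately show ?thesis
            unfolding iff w_def snd_letter_def d[symmetric] by (cases "P (h i div p)") auto
        qed
      qed
      then show ?thesis using div_le_mono[OF hi, of p] by simp
    qed
    moreover have "h i div p < k" if "i \<in> {1..n}" for i
      using hk[OF that] \<open>0 < p\<close> by (simp add: less_mult_imp_div_less)
    ultimately show ?thesis by (simp add: compat_def f_def)
  qed
  have g: "g \<in> compat n (inv \<pi>) Q p"
  proof -
    have "w (inv \<pi> m) \<le> w (inv \<pi> (Suc m)) \<and> (w (inv \<pi> m) = w (inv \<pi> (Suc m)) \<longrightarrow>
      (Q (w (inv \<pi> m)) \<longleftrightarrow> inv \<pi> m < inv \<pi> (Suc m)))" if "1 \<le> m" "m < n" for m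
    proof -
      have "m \<in> {1..n}" "Suc m \<in> {1..n}" using that by auto
      then have i: "inv \<pi> m \<in> {1..n}" "inv \<pi> (Suc m) \<in> {1..n}"
        by (simp_all only: permutes_in_image[OF permutes_inv[OF \<pi>]])
      have "\<pi> (inv \<pi> m) < \<pi> (inv \<pi> (Suc m))" by (simp add: permutes_inverses[OF \<pi>])
      then show ?thesis unfolding less_iff[OF i] by (auto split: if_splits)
    qed
    moreover have "w i < p" for i using \<open>0 < p\<close> by (simp add: w_def)
    ultimately show ?thesis by (simp add: compat_def g_def)
  qed
  have "h = cauchy_map n P p (\<pi>, f, g)"
  proof (rule extensionalityI[of _ "{1..n}"])
    fix i assume i: "i \<in> {1..n}"
    then have "\<pi> i \<in> {1..n}" by (simp only: permutes_in_image[OF \<pi>])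
    then have "g (\<pi> i) = w i" by (simp add: g_def permutes_inverses[OF \<pi>])
    then show "h i = cauchy_map n P p (\<pi>, f, g) i"
      using i \<open>0 < p\<close> by (simp add: cauchy_map_def f_def w_def)
  qed (use h in \<open>auto simp: compat_def cauchy_map_def PiE_iff\<close>)
  then show ?thesis using \<pi> f g by (auto simp: cauchy_triples_def)
qed

lemma sum_card_compat:
  "(\<Sum>\<pi> | \<pi> permutes {1..n}. card (compat n \<pi> P k) * card (compat n (inv \<pi>) Q p)) =
     card (compat n id (signs_agree P Q p) (k * p))"
proof (cases "0 < p \<or> n = 0")
  case True
  have "bij_betw (cauchy_map n P p) (cauchy_triples n P k Q p) (compat n id (signs_agree P Q p) (k * p))"
    if "0 < p"
    using cauchy_map_in_compat cauchy_map_surj[OF that] by (intro bij_betw_imageI inj_on_cauchy_map) auto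
  then have "card (cauchy_triples n P k Q p) = card (compat n id (signs_agree P Q p) (k * p))" if "0 < p"
    using that by (metis bij_betw_same_card)
  moreover have "card (cauchy_triples n P k Q p) =
      (\<Sum>\<pi> | \<pi> permutes {1..n}. card (compat n \<pi> P k) * card (compat n (inv \<pi>) Q p))"
    unfolding cauchy_triples_def
    by (subst card_SigmaI) (auto simp: finite_compat finite_permutations card_cartesian_product)
  ultimately show ?thesis using True by (cases "0 < p") auto
next
  case False
  \<comment> \<open>Here \<open>p = 0\<close> and \<open>n > 0\<close>, so both sides count
    sequences over an empty alphabet.\<close>
  then have "compat n \<sigma> R 0 = {}" for \<sigma> R by (auto simp: compat_def PiE_iff)
  then show ?thesis using False by simp
qed

subsection \<open>Changes of direction\<close>

definition ascent :: "(nat \<Rightarrow> nat) \<Rightarrow> nat \<Rightarrow> bool" where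
  "ascent \<pi> i \<longleftrightarrow> \<pi> i < \<pi> (Suc i)"

text \<open>\<open>b\<close> stands for the direction of a step before the first one. Taking the
  true first direction leads to \<open>br\<close>, taking a descent leads to
  \<open>pk\<close>.\<close>

definition changes :: "bool \<Rightarrow> (nat \<Rightarrow> bool) \<Rightarrow> nat \<Rightarrow> nat" where
  "changes b asc n = card {i. 1 \<le> i \<and> i < n \<and> asc i \<noteq> (if i = 1 then b else asc (i - 1))}"

lemma card_less_Suc_insert:
  fixes Q :: "nat \<Rightarrow> bool"
  assumes "1 \<le> n"
  shows "card {i. 1 \<le> i \<and> i < Suc n \<and> Q i} = card {i. 1 \<le> i \<and> i < n \<and> Q i} + (if Q n then 1 else 0)"
proof -
  have "{i. 1 \<le> i \<and> i < Suc n \<and> Q i} = {i. 1 \<le> i \<and> i < n \<and> Q i} \<union> (if Q n then {n} else {})"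
    using assms by (auto simp: less_Suc_eq)
  then show ?thesis by simp
qed

lemma changes_1 [simp]: "changes b asc (Suc 0) = 0"
  by (auto simp: changes_def)

lemma changes_Suc:
  "1 \<le> n \<Longrightarrow> changes b asc (Suc n) =
     changes b asc n + (if asc n \<noteq> (if n = 1 then b else asc (n - 1)) then 1 else 0)"
  unfolding changes_def by (rule card_less_Suc_insert)

lemma changes_less: "1 \<le> n \<Longrightarrow> changes b asc n < n"
  by (induction n rule: dec_induct) (auto simp: changes_Suc)

text \<open>The two choices of the initial direction differ only in whether position 1 counts as a
  change.\<close>

lemma changes_initial:
  assumes "2 \<le> n"
  shows "changes (asc 1) asc n \<le> n - 2"
    and "changes (\<not> asc 1) asc n = Suc (changes (asc 1) asc n)"
  using assms by (induction n rule: dec_induct) (auto simp: changes_Suc numeral_2_eq_2)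

text \<open>After a fictitious descent the changes go alternately to an ascent and to a descent, and
  the changes to a descent are the peaks.\<close>

lemma pk_eq_changes_div_2:
  assumes "\<pi> permutes {1..n}" "1 \<le> n"
  shows "pk n \<pi> = changes False (ascent \<pi>) n div 2"
proof -
  define pks where "pks k = card {i. 1 \<le> i \<and> i < k \<and> (2 \<le> i \<and> ascent \<pi> (i - 1) \<and> \<not> ascent \<pi> i)}" for k
  have pks_Suc: "pks (Suc k) = pks k + (if 2 \<le> k \<and> ascent \<pi> (k - 1) \<and> \<not> ascent \<pi> k then 1 else 0)"
    if "1 \<le> k" for k
    unfolding pks_def using that by (rule card_less_Suc_insert)
  \<comment> \<open>Invariant: one change still awaits its peak exactly when the last of the steps
    \<open>1, ..., k - 1\<close> is an ascent.\<close>
  have "changes False (ascent \<pi>) k = 2 * pks k + (if 2 \<le> k \<and> ascent \<pi> (k - 1) then 1 else 0)"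
    if "1 \<le> k" for k
    using that
  proof (induction k rule: dec_induct)
    case base
    show ?case by (simp add: pks_def)
  next
    case (step k)
    then show ?case
      by (cases "k = 1") (auto simp: changes_Suc pks_Suc)
  qed
  from this[of n] have "changes False (ascent \<pi>) n div 2 = pks n" using assms(2) by simp
  also have "pks n = pk n \<pi>"
  proof -
    have "ascent \<pi> (i - 1) \<longleftrightarrow> \<pi> (i - 1) < \<pi> i" if "2 \<le> i" for i
      using that by (simp add: ascent_def)
    moreover have "\<not> ascent \<pi> i \<longleftrightarrow> \<pi> (i + 1) < \<pi> i" for i
      using inj_eq[OF permutes_inj[OF assms(1)], of i "Suc i"] by (simp add: ascent_def not_less le_less)
    ultimately show ?thesis unfolding pks_def pk_def by (intro arg_cong[where f = card]) auto
  qed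
  finally show ?thesis ..
qed

section \<open>Biruns and their right ends\<close>

lemma monotone_segmentD:
  assumes L: "monotone_segment n \<pi> a b"
  shows "1 \<le> a" "a \<le> b" "b \<le> n"
    and "i \<in> {a..<b} \<Longrightarrow> j \<in> {a..<b} \<Longrightarrow> ascent \<pi> i = ascent \<pi> j"
proof -
  show "1 \<le> a" "a \<le> b" "b \<le> n" using L by (auto simp: monotone_segment_def)
  show "ascent \<pi> i = ascent \<pi> j" if "i \<in> {a..<b}" "j \<in> {a..<b}"
  proof -
    have "i \<in> {a..b}" "Suc i \<in> {a..b}" "j \<in> {a..b}" "Suc j \<in> {a..b}" using that by auto
    then show ?thesis
      using L monotone_onD[of "{a..b}" "(<)" "(<)" \<pi>] monotone_onD[of "{a..b}" "(<)" "(>)" \<pi>]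
      unfolding monotone_segment_def ascent_def by (meson lessI less_asym)
  qed
qed

text \<open>Injectivity rules out ties, so steps that all have the same value of
  \<open>ascent\<close> are all strict rises or all strict falls, and transitivity extends this to
  the segment.\<close>

lemma monotone_segmentI:
  assumes \<pi>: "\<pi> permutes {1..n}" and ab: "1 \<le> a" "a \<le> b" "b \<le> n"
    and R: "\<And>i j. i \<in> {a..<b} \<Longrightarrow> j \<in> {a..<b} \<Longrightarrow> ascent \<pi> i = ascent \<pi> j"
  shows "monotone_segment n \<pi> a b"
proof -
  have ne: "\<pi> i \<noteq> \<pi> (Suc i)" for i using permutes_inj[OF \<pi>] by (simp add: inj_eq)
  have up: "\<pi> i < \<pi> j" if "\<forall>k\<in>{a..<b}. \<pi> k < \<pi> (Suc k)" "a \<le> i" "i < j" "j \<le> b" for i j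
  proof -
    have "Suc i \<le> j" using that by simp
    then have "j \<le> b \<longrightarrow> \<pi> i < \<pi> j"
    proof (induction rule: dec_induct)
      case (step k)
      then show ?case using that(1,2) by (auto dest!: bspec[of _ _ k] intro: less_trans)
    qed (use that in auto)
    then show ?thesis using that by simp
  qed
  have down: "\<pi> i > \<pi> j" if "\<forall>k\<in>{a..<b}. \<pi> k > \<pi> (Suc k)" "a \<le> i" "i < j" "j \<le> b" for i j
  proof -
    have "Suc i \<le> j" using that by simp
    then have "j \<le> b \<longrightarrow> \<pi> i > \<pi> j"
    proof (induction rule: dec_induct)
      case (step k)
      then show ?case using that(1,2) by (auto dest!: bspec[of _ _ k] intro: less_trans)
    qed (use that in auto)
    then show ?thesis using that by simp
  qed
  have "(\<forall>k\<in>{a..<b}. \<pi> k < \<pi> (Suc k)) \<or> (\<forall>k\<in>{a..<b}. \<pi> k > \<pi> (Suc k))"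
  proof (cases "\<forall>k\<in>{a..<b}. \<pi> k < \<pi> (Suc k)")
    case False
    then obtain k where k: "k \<in> {a..<b}" "\<not> ascent \<pi> k" by (auto simp: ascent_def)
    then have "\<not> \<pi> j < \<pi> (Suc j)" if "j \<in> {a..<b}" for j
      using R that unfolding ascent_def by blast
    then show ?thesis using ne by (meson linorder_neqE_nat)
  qed blast
  then have "strict_mono_on {a..b} \<pi> \<or> strict_antimono_on {a..b} \<pi>"
  proof
    assume "\<forall>k\<in>{a..<b}. \<pi> k < \<pi> (Suc k)"
    then show ?thesis by (intro disjI1 monotone_onI up) auto
  next
    assume "\<forall>k\<in>{a..<b}. \<pi> k > \<pi> (Suc k)"
    then show ?thesis by (intro disjI2 monotone_onI down) auto
  qed
  then show ?thesis using ab by (simp add: monotone_segment_def)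
qed

text \<open>A birun is determined by its right end, and the right ends are \<open>n\<close> and the
  positions where the direction changes.\<close>

lemma br_eq_changes:
  assumes \<pi>: "\<pi> permutes {1..n}" and n: "2 \<le> n"
  shows "br n \<pi> = Suc (changes (ascent \<pi> 1) (ascent \<pi>) n)"
proof -
  let ?a = "ascent \<pi>"
  define T where "T = {i. 1 \<le> i \<and> i < n \<and> ?a i \<noteq> (if i = 1 then ?a 1 else ?a (i - 1))}"
  have T: "i \<in> T \<longleftrightarrow> 2 \<le> i \<and> i < n \<and> ?a i \<noteq> ?a (i - 1)" for i
    by (cases "i = 1") (auto simp: T_def)
  have "bij_betw snd {(a, b). birun n \<pi> a b} (insert n T)"
  proof (rule bij_betw_imageI)
    show "inj_on snd {(a, b). birun n \<pi> a b}"
    proof -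
      have "a = a'" if "birun n \<pi> a b" "birun n \<pi> a' b" for a a' b
        using that nat_le_linear[of a a'] unfolding birun_def by blast
      then show ?thesis by (auto simp: inj_on_def)
    qed
    show "snd ` {(a, b). birun n \<pi> a b} = insert n T"
    proof (intro equalityI subsetI)
      fix b assume "b \<in> snd ` {(a, b). birun n \<pi> a b}"
      then obtain a where ab: "birun n \<pi> a b" by auto
      then have m: "monotone_segment n \<pi> a b"
        and mx: "\<And>b'. monotone_segment n \<pi> a b' \<Longrightarrow> b \<le> b' \<Longrightarrow> b' = b"
        by (auto simp: birun_def)
      show "b \<in> insert n T"
      proof (rule ccontr)
        assume b: "b \<notin> insert n T"
        then have "b < n" using monotone_segmentD(3)[OF m] by auto
        have ext: "?a i = ?a b" if "i \<in> {a..<b}" for i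
        proof -
          have "?a i = ?a (b - 1)" using that by (intro monotone_segmentD(4)[OF m]) auto
          moreover have "?a (b - 1) = ?a b" using b \<open>b < n\<close> that monotone_segmentD(1)[OF m] by (auto simp: T)
          ultimately show ?thesis by simp
        qed
        have ext': "?a i = ?a b" if "i \<in> {a..<Suc b}" for i
          using that ext[of i] by (cases "i = b") auto
        have "?a i = ?a j" if "i \<in> {a..<Suc b}" "j \<in> {a..<Suc b}" for i j
          using ext'[OF that(1)] ext'[OF that(2)] by simp
        then have "monotone_segment n \<pi> a (Suc b)"
          by (rule monotone_segmentI[OF \<pi>, rotated 3])
             (use monotone_segmentD(1-3)[OF m] \<open>b < n\<close> in simp_all)
        then show False using mx[of "Suc b"] by simp
      qed
    next
      fix b assume b: "b \<in> insert n T"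
      then have b2: "2 \<le> b" "b \<le> n" using n by (auto simp: T)
      \<comment> \<open>The least left end gives maximality to the left. As the two-element segment
        shows, the segment contains the step \<open>b - 1\<close>, so an extension beyond
        \<open>b\<close> would contain two steps of different direction.\<close>
      define a where "a = (LEAST a. monotone_segment n \<pi> a b)"
      have m1: "monotone_segment n \<pi> (b - 1) b"
      proof -
        have "i = j" if "i \<in> {b - 1..<b}" "j \<in> {b - 1..<b}" for i j
          using that by auto
        then have "?a i = ?a j" if "i \<in> {b - 1..<b}" "j \<in> {b - 1..<b}" for i j
          using that by blast
        then show ?thesis by (rule monotone_segmentI[OF \<pi>, rotated 3]) (use b2 in simp_all)
      qed
      then have m: "monotone_segment n \<pi> a b" and "a \<le> b - 1"
        unfolding a_def by (rule LeastI, rule Least_le)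
      have "a' = a \<and> b' = b" if m': "monotone_segment n \<pi> a' b'" "a' \<le> a" "b \<le> b'" for a' b'
      proof -
        have "b' = b"
        proof (rule ccontr)
          assume "b' \<noteq> b"
          then have "b < b'" using that by simp
          then have "b \<in> T" using b monotone_segmentD(3)[OF m'(1)] by auto
          moreover have "?a b = ?a (b - 1)"
            using m' \<open>b < b'\<close> \<open>a \<le> b - 1\<close> b2 by (intro monotone_segmentD(4)[OF m'(1)]) auto
          ultimately show False by (simp add: T)
        qed
        moreover have "a \<le> a'"
          unfolding a_def using m'(1) \<open>b' = b\<close> by (intro Least_le) simp
        ultimately show ?thesis using m' by simp
      qed
      then have "birun n \<pi> a b" using m by (auto simp: birun_def)
      then show "b \<in> snd ` {(a, b). birun n \<pi> a b}" by force
    qed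
  qed
  then have "br n \<pi> = card (insert n T)" unfolding br_def by (rule bij_betw_same_card)
  also have "\<dots> = Suc (card T)" by (rule card_insert_disjoint) (auto simp: T_def)
  also have "card T = changes (?a 1) ?a n" by (simp add: T_def changes_def)
  finally show ?thesis .
qed

subsection \<open>Generating functions in the size of the alphabet\<close>

text \<open>The expansion of 1/(1 - X^2), given by coefficients so that its parity is
  visible.\<close>

definition even_geom :: "rat fps" where
  "even_geom = Abs_fps (\<lambda>v. if even v then 1 else 0)"

lemma one_minus_X2_even_geom: "(1 - fps_X\<^sup>2) * even_geom = 1"
proof (rule fps_ext)
  fix v
  show "((1 - fps_X\<^sup>2) * even_geom) $ v = (1 :: rat fps) $ v"
    by (auto simp: left_diff_distrib even_geom_def fps_X_power_mult_nth elim: oddE)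
qed

definition geom :: "rat fps" where
  "geom = Abs_fps (\<lambda>_. 1)"

lemma geom_mult: "geom * (1 - fps_X) = 1"
proof (rule fps_ext)
  fix v
  show "(geom * (1 - fps_X)) $ v = 1 $ v"
    by (cases v) (auto simp: ring_distribs geom_def)
qed

lemma partial_sums_fps:
  fixes a :: "nat \<Rightarrow> rat"
  shows "(1 - fps_X) * Abs_fps (\<lambda>m. \<Sum>v<m. a v) = fps_X * Abs_fps a"
proof (rule fps_ext)
  fix m
  show "((1 - fps_X) * Abs_fps (\<lambda>m. \<Sum>v<m. a v)) $ m = (fps_X * Abs_fps a) $ m"
    by (cases m) (auto simp: ring_distribs)
qed

definition ending_fps :: "(nat \<Rightarrow> bool) \<Rightarrow> (nat \<Rightarrow> bool) \<Rightarrow> nat \<Rightarrow> rat fps" where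
  "ending_fps asc P n = Abs_fps (\<lambda>v. of_nat (ending_count asc P n v))"

lemma ending_fps_1: "(1 - fps_X) * ending_fps asc P 1 = 1"
  using geom_mult by (simp add: ending_fps_def geom_def mult.commute)

text \<open>The factor \<open>1 - fps_X\<close> turns the sum over smaller letters in
  \<open>ending_count\<close> into a shift by \<open>fps_X\<close>.\<close>

lemma ending_fps_Suc:
  assumes "1 \<le> n"
  shows "(1 - fps_X) * ending_fps asc P (Suc n) = fps_X * ending_fps asc P n +
    (1 - fps_X) * Abs_fps (\<lambda>v. if P v \<longleftrightarrow> asc n then ending_fps asc P n $ v else 0)"
proof -
  obtain k where n: "n = Suc k" using assms by (cases n) auto
  have "ending_fps asc P (Suc n) = Abs_fps (\<lambda>v. \<Sum>u<v. of_nat (ending_count asc P n u)) +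
    Abs_fps (\<lambda>v. if P v \<longleftrightarrow> asc n then ending_fps asc P n $ v else 0)"
    by (rule fps_ext) (simp add: ending_fps_def n)
  then show ?thesis
    by (simp only: distrib_left partial_sums_fps) (simp add: ending_fps_def)
qed

definition compat_fps :: "nat \<Rightarrow> (nat \<Rightarrow> nat) \<Rightarrow> (nat \<Rightarrow> bool) \<Rightarrow> rat fps" where
  "compat_fps n \<sigma> P = Abs_fps (\<lambda>m. of_nat (card (compat n \<sigma> P m)))"

lemma compat_fps_eq:
  "1 \<le> n \<Longrightarrow> (1 - fps_X) * compat_fps n \<sigma> P = fps_X * ending_fps (ascent \<sigma>) P n"
  using partial_sums_fps[of "\<lambda>v. of_nat (ending_count (ascent \<sigma>) P n v)"]
  by (simp add: compat_fps_def card_compat ascent_def[abs_def] ending_fps_def)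

lemma one_minus_X_nonzero [simp]: "1 - fps_X \<noteq> (0 :: rat fps)"
proof
  assume "1 - fps_X = (0 :: rat fps)"
  then have "(1 - fps_X :: rat fps) $ 0 = 0" by (simp only: fps_zero_nth)
  then show False by simp
qed

section \<open>All letters positive: descents\<close>

text \<open>In the recursion each ascent multiplies the series by 1/(1 - X) and each descent by X/(1
  - X).\<close>

lemma ending_fps_all_positive:
  assumes "1 \<le> n"
  shows "(1 - fps_X) ^ n * ending_fps asc (\<lambda>_. True) n = fps_X ^ card {i. 1 \<le> i \<and> i < n \<and> \<not> asc i}"
  using assms
proof (induction n rule: dec_induct)
  case base
  have "{i. 1 \<le> i \<and> i < 1 \<and> \<not> asc i} = {}" by auto
  then show ?case
    using ending_fps_1[of asc "\<lambda>_. True"] by (simp only: card.empty power_0 power_one_right)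
next
  case (step n)
  let ?e = "ending_fps asc (\<lambda>_. True)"
  have "Abs_fps (\<lambda>v. if asc n then ?e n $ v else 0) = (if asc n then ?e n else 0)"
    by (rule fps_ext) simp
  then have e: "(1 - fps_X) * ?e (Suc n) = fps_X * ?e n + (1 - fps_X) * (if asc n then ?e n else 0)"
    using ending_fps_Suc[OF step(1), of asc "\<lambda>_. True"] by simp
  have "(1 - fps_X) ^ Suc n * ?e (Suc n) = (1 - fps_X) ^ n * ((1 - fps_X) * ?e (Suc n))"
    by simp
  also have "\<dots> = (if asc n then 1 else fps_X) * ((1 - fps_X) ^ n * ?e n)"
    unfolding e by (simp add: algebra_simps)
  also have "\<dots> = fps_X ^ card {i. 1 \<le> i \<and> i < Suc n \<and> \<not> asc i}"
    unfolding card_less_Suc_insert[OF step(1)] step.IH by simp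
  finally show ?case .
qed

lemma compat_fps_all_positive:
  assumes "\<sigma> permutes {1..n}" "1 \<le> n"
  shows "(1 - fps_X) ^ (n + 1) * compat_fps n \<sigma> (\<lambda>_. True) = fps_X ^ (des n \<sigma> + 1)"
proof -
  have "\<not> ascent \<sigma> i \<longleftrightarrow> \<sigma> (i + 1) < \<sigma> i" for i
    using inj_eq[OF permutes_inj[OF assms(1)], of i "Suc i"] by (simp add: ascent_def not_less le_less)
  then have d: "des n \<sigma> = card {i. 1 \<le> i \<and> i < n \<and> \<not> ascent \<sigma> i}" by (simp add: des_def)
  have "(1 - fps_X) ^ (n + 1) * compat_fps n \<sigma> (\<lambda>_. True) =
      (1 - fps_X) ^ n * ((1 - fps_X) * compat_fps n \<sigma> (\<lambda>_. True))" by simp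
  also have "\<dots> = fps_X * ((1 - fps_X) ^ n * ending_fps (ascent \<sigma>) (\<lambda>_. True) n)"
    unfolding compat_fps_eq[OF assms(2)] by (simp add: algebra_simps)
  also have "\<dots> = fps_X ^ (des n \<sigma> + 1)"
    unfolding ending_fps_all_positive[OF assms(2)] d by simp
  finally show ?thesis .
qed

section \<open>Alternating signs: changes of direction\<close>

definition has_parity :: "bool \<Rightarrow> rat fps \<Rightarrow> bool" where
  "has_parity b g \<longleftrightarrow> (\<forall>v. g $ v \<noteq> 0 \<longrightarrow> (even v \<longleftrightarrow> b))"

lemma has_parity_mult:
  assumes "has_parity b f" "has_parity c g"
  shows "has_parity (b \<longleftrightarrow> c) (f * g)"
  unfolding has_parity_def
proof (intro allI impI)
  fix v assume "(f * g) $ v \<noteq> 0"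
  then obtain i where i: "i \<le> v" "f $ i * g $ (v - i) \<noteq> 0"
    unfolding fps_mult_nth by (metis (no_types, lifting) atLeastAtMost_iff sum.neutral)
  then have "even i \<longleftrightarrow> b" "even (v - i) \<longleftrightarrow> c"
    using assms by (auto simp: has_parity_def)
  moreover have "even v \<longleftrightarrow> (even i \<longleftrightarrow> even (v - i))" using i(1) by auto
  ultimately show "even v \<longleftrightarrow> (b \<longleftrightarrow> c)" by blast
qed

lemma has_parity_intros:
  "has_parity True even_geom" "has_parity False (2 * fps_X)" "has_parity True (1 + fps_X\<^sup>2)"
  by (auto simp: has_parity_def even_geom_def fps_numeral_fps_const split: if_splits)

text \<open>If \<open>g\<close> has only coefficients of one parity, then \<open>g\<close> and
  \<open>fps_X * g\<close> are the parts of \<open>(1 + fps_X) * g\<close> of the two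
  parities.\<close>

lemma Abs_fps_select_parity:
  assumes "has_parity b g"
  shows "Abs_fps (\<lambda>v. if even v \<longleftrightarrow> c then ((1 + fps_X) * g) $ v else 0) = (if b = c then g else fps_X * g)"
proof (rule fps_ext)
  fix v
  have "g $ v = 0" if "even v \<noteq> b" for v using assms that by (auto simp: has_parity_def)
  from this[of v] this[of "v - 1"]
  show "Abs_fps (\<lambda>v. if even v \<longleftrightarrow> c then ((1 + fps_X) * g) $ v else 0) $ v =
      (if b = c then g else fps_X * g) $ v"
    by (cases v) (auto simp: ring_distribs)
qed

text \<open>
  After an ascent a positive letter and its successor end equally many sequences, after a descent
  a negative letter and its successor do: this is the factor \<open>1 + fps_X\<close> below. The initial
  value \<open>b\<close> of \<open>changes\<close> acts as a fictitious first step, an ascent iff the first letter is positive.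
\<close>

definition alt_fps :: "nat \<Rightarrow> nat \<Rightarrow> rat fps" where
  "alt_fps n c = even_geom ^ n * (2 * fps_X) ^ c * (1 + fps_X\<^sup>2) ^ (n - 1 - c)"

text \<open>The parity statement is carried along because the recursion keeps only the letters of
  one sign, and parity tells which half of \<open>(1 + fps_X) * g\<close> that is.\<close>

lemma ending_fps_alternating:
  fixes asc :: "nat \<Rightarrow> bool" and b :: bool
  defines "P \<equiv> \<lambda>v::nat. even v \<longleftrightarrow> b"
  assumes "1 \<le> n"
  shows "ending_fps asc P n = (1 + fps_X) * alt_fps n (changes b asc n) \<and>
    has_parity ((if n = 1 then b else asc (n - 1)) = b) (alt_fps n (changes b asc n))"
  using \<open>1 \<le> n\<close>
proof (induction n rule: dec_induct)
  case base
  have "(1 - fps_X) * ((1 + fps_X) * even_geom) = 1"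
    using one_minus_X2_even_geom by (simp add: algebra_simps power2_eq_square)
  then have "(1 - fps_X) * ending_fps asc P 1 = (1 - fps_X) * ((1 + fps_X) * even_geom)"
    using ending_fps_1[of asc P] by simp
  then have "ending_fps asc P 1 = (1 + fps_X) * even_geom"
    by (simp only: mult_cancel_left one_minus_X_nonzero) simp
  then show ?case using has_parity_intros by (simp add: alt_fps_def)
next
  case (step n)
  let ?c = "changes b asc n" and ?l = "if n = 1 then b else asc (n - 1)"
  define g where "g = alt_fps n ?c"
  define g' where "g' = alt_fps (Suc n) (changes b asc (Suc n))"
  have g: "ending_fps asc P n = (1 + fps_X) * g" "has_parity (?l = b) g"
    using step.IH by (simp_all add: g_def)
  have c: "?c < n" using changes_less[OF step(1)] .
  have g': "g' = g * (even_geom * (if asc n = ?l then 1 + fps_X\<^sup>2 else 2 * fps_X))"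
  proof (cases "asc n = ?l")
    case True
    then have "changes b asc (Suc n) = ?c" using step(1) by (simp add: changes_Suc)
    moreover have "Suc n - 1 - ?c = Suc (n - 1 - ?c)" using c by simp
    ultimately show ?thesis using True by (simp add: g_def g'_def alt_fps_def)
  next
    case False
    then have "changes b asc (Suc n) = Suc ?c" using step(1) by (simp add: changes_Suc)
    moreover have "Suc n - 1 - Suc ?c = n - 1 - ?c" using c by simp
    ultimately show ?thesis using False by (simp add: g_def g'_def alt_fps_def)
  qed
  have "Abs_fps (\<lambda>v. if P v \<longleftrightarrow> asc n then ending_fps asc P n $ v else 0) =
      Abs_fps (\<lambda>v. if even v \<longleftrightarrow> (asc n = b) then ((1 + fps_X) * g) $ v else 0)"
    unfolding g(1) unfolding P_def by (intro arg_cong[where f = Abs_fps] ext if_cong) auto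
  also have "\<dots> = (if asc n = ?l then g else fps_X * g)"
    unfolding Abs_fps_select_parity[OF g(2)] by (cases "asc n"; cases b; cases ?l) auto
  finally have e: "(1 - fps_X) * ending_fps asc P (Suc n) = fps_X * ((1 + fps_X) * g) +
      (1 - fps_X) * (if asc n = ?l then g else fps_X * g)"
    using ending_fps_Suc[OF step(1), of asc P] g(1) by simp
  \<comment> \<open>A step that keeps the direction contributes X(1 + X) + (1 - X) = 1 + X^2, a
    change contributes X(1 + X) + (1 - X)X = 2X.\<close>
  have "(1 - fps_X) * ((1 + fps_X) * g') =
      ((1 - fps_X\<^sup>2) * even_geom) * (g * (if asc n = ?l then 1 + fps_X\<^sup>2 else 2 * fps_X))"
    unfolding g' by (simp add: algebra_simps power2_eq_square)
  also have "\<dots> = (1 - fps_X) * ending_fps asc P (Suc n)"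
    unfolding e one_minus_X2_even_geom by (simp add: algebra_simps power2_eq_square)
  finally have "ending_fps asc P (Suc n) = (1 + fps_X) * g'"
    by (simp only: mult_cancel_left one_minus_X_nonzero) simp
  moreover have "has_parity (asc n = b) g'"
  proof -
    have "has_parity ((?l = b) = (True = (asc n = ?l))) g'"
      unfolding g' using g(2) has_parity_intros by (intro has_parity_mult) auto
    then show ?thesis by (cases "asc n"; cases b; cases ?l) auto
  qed
  ultimately show ?case using step(1) by (simp add: g'_def)
qed

lemma compat_fps_alternating:
  assumes "1 \<le> n"
  shows "(1 - fps_X) * compat_fps n \<sigma> (\<lambda>v. even v \<longleftrightarrow> b) =
    fps_X * (1 + fps_X) * alt_fps n (changes b (ascent \<sigma>) n)"
  using compat_fps_eq[OF assms] ending_fps_alternating[OF assms] by (simp add: mult.assoc)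

text \<open>Whatever the first step is, the two sign patterns see \<open>br n \<pi> - 1\<close> and
  \<open>br n \<pi>\<close> changes. Their sum produces (1 + X^2) + 2X = (1 + X)^2, which explains
  the cube; the factor 2 on the left completes \<open>(2 * fps_X) ^ br n \<pi>\<close>.\<close>

lemma compat_fps_br:
  assumes \<pi>: "\<pi> permutes {1..n}" and n: "2 \<le> n"
  shows "2 * ((1 - fps_X) * (1 - fps_X\<^sup>2) ^ n * (compat_fps n \<pi> even + compat_fps n \<pi> odd)) =
    (1 + fps_X) ^ 3 * ((1 + fps_X\<^sup>2) ^ (n - 1 - br n \<pi>) * (2 * fps_X) ^ br n \<pi>)"
    and "br n \<pi> \<le> n - 1"
proof -
  define c where "c = changes (ascent \<pi> 1) (ascent \<pi>) n"
  have br: "br n \<pi> = Suc c" using br_eq_changes[OF assms] by (simp add: c_def)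
  have cn: "c \<le> n - 2" and c': "changes (\<not> ascent \<pi> 1) (ascent \<pi>) n = Suc c"
    using changes_initial[OF n, of "ascent \<pi>"] by (simp_all add: c_def)
  show "br n \<pi> \<le> n - 1" using br cn n by simp
  have even: "(\<lambda>v::nat. even v \<longleftrightarrow> True) = even" and odd: "(\<lambda>v::nat. even v \<longleftrightarrow> False) = odd" by auto
  have n1: "1 \<le> n" using n by simp
  have sum: "alt_fps n (changes True (ascent \<pi>) n) + alt_fps n (changes False (ascent \<pi>) n) =
      alt_fps n c + alt_fps n (Suc c)"
    using c' unfolding c_def by (cases "ascent \<pi> 1") auto
  have z: "(1 - fps_X\<^sup>2) ^ n * even_geom ^ n = 1"
    by (simp add: power_mult_distrib[symmetric] one_minus_X2_even_geom)
  define m where "m = n - 2 - c"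
  have m: "n - 1 - c = Suc m" "n - 1 - Suc c = m" using cn n by (auto simp: m_def)
  define S where "S = compat_fps n \<pi> even + compat_fps n \<pi> odd"
  have S: "(1 - fps_X) * S = fps_X * (1 + fps_X) * (alt_fps n c + alt_fps n (Suc c))"
    unfolding S_def sum[symmetric] distrib_left
      compat_fps_alternating[OF n1, of \<pi> True, unfolded even]
      compat_fps_alternating[OF n1, of \<pi> False, unfolded odd] ..
  have "2 * ((1 - fps_X) * (1 - fps_X\<^sup>2) ^ n * S) = 2 * ((1 - fps_X\<^sup>2) ^ n * ((1 - fps_X) * S))"
    by (simp only: mult_ac)
  also have "\<dots> = 2 * ((1 - fps_X\<^sup>2) ^ n * (fps_X * (1 + fps_X) * (alt_fps n c + alt_fps n (Suc c))))"
    unfolding S ..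
  also have "\<dots> = ((1 - fps_X\<^sup>2) ^ n * even_geom ^ n) * (1 + fps_X) *
     ((2 * fps_X) ^ Suc c * (1 + fps_X\<^sup>2) ^ m * ((1 + fps_X\<^sup>2) + 2 * fps_X))"
    unfolding alt_fps_def m by (simp add: algebra_simps)
  also have "\<dots> = (1 + fps_X) ^ 3 * ((1 + fps_X\<^sup>2) ^ m * (2 * fps_X) ^ Suc c)"
    unfolding z by (simp add: algebra_simps power2_eq_square power3_eq_cube)
  finally show "2 * ((1 - fps_X) * (1 - fps_X\<^sup>2) ^ n * (compat_fps n \<pi> even + compat_fps n \<pi> odd)) =
    (1 + fps_X) ^ 3 * ((1 + fps_X\<^sup>2) ^ (n - 1 - br n \<pi>) * (2 * fps_X) ^ br n \<pi>)"
    unfolding br m S_def .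
qed

section \<open>Alphabets of even size: peaks\<close>

definition bisect :: "rat fps \<Rightarrow> rat fps" where
  "bisect f = Abs_fps (\<lambda>j. f $ (2 * j))"

lemma bisect_nth [simp]: "bisect f $ j = f $ (2 * j)"
  by (simp add: bisect_def)

lemma bisect_X2: "bisect (fps_X\<^sup>2 * f) = fps_X * bisect f"
  by (rule fps_ext) (auto simp: fps_X_power_mult_nth right_diff_distrib')

lemma bisect_add: "bisect (f + g) = bisect f + bisect g"
  by (rule fps_ext) simp

lemma bisect_diff: "bisect (f - g) = bisect f - bisect g"
  by (rule fps_ext) simp

text \<open>A factor that is a series in X^2 passes through the bisection with X^2 replaced by X;
  the next two lemmas are further instances.\<close>

lemma bisect_pow_one_minus: "bisect ((1 - fps_X\<^sup>2) ^ k * f) = (1 - fps_X) ^ k * bisect f"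
proof (induction k)
  case (Suc k)
  have "bisect ((1 - fps_X\<^sup>2) ^ Suc k * f) =
      bisect ((1 - fps_X\<^sup>2) ^ k * f - fps_X\<^sup>2 * ((1 - fps_X\<^sup>2) ^ k * f))"
    by (simp add: algebra_simps)
  then show ?case unfolding bisect_diff bisect_X2 Suc by (simp add: algebra_simps)
qed simp

lemma bisect_pow_one_plus: "bisect ((1 + fps_X\<^sup>2) ^ k * f) = (1 + fps_X) ^ k * bisect f"
proof (induction k)
  case (Suc k)
  have "bisect ((1 + fps_X\<^sup>2) ^ Suc k * f) =
      bisect ((1 + fps_X\<^sup>2) ^ k * f + fps_X\<^sup>2 * ((1 + fps_X\<^sup>2) ^ k * f))"
    by (simp add: algebra_simps)
  then show ?case unfolding bisect_add bisect_X2 Suc by (simp add: algebra_simps)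
qed simp

lemma bisect_pow_four_X2: "bisect ((4 * fps_X\<^sup>2) ^ k * f) = (4 * fps_X) ^ k * bisect f"
proof (induction k)
  case (Suc k)
  have four: "bisect (4 * f) = 4 * bisect f" for f
    by (rule fps_ext) (simp add: numeral_fps_const)
  have "bisect ((4 * fps_X\<^sup>2) ^ Suc k * f) = bisect (fps_X\<^sup>2 * (4 * ((4 * fps_X\<^sup>2) ^ k * f)))"
    by (simp add: algebra_simps)
  then show ?case unfolding bisect_X2 four Suc by (simp add: algebra_simps)
qed simp

lemma bisect_parity: "has_parity False f \<Longrightarrow> bisect f = 0"
  by (rule fps_ext) (auto simp: has_parity_def)

text \<open>Starting with a negative letter makes the relevant count \<open>changes False\<close>,
  whose half is \<open>pk\<close>. One more factor 1 + X makes the denominator a power of 1 - X^2.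
  The numerator then contains 2X(1 + X^2) + 4X^2, of which bisection keeps the second summand for
  even \<open>c\<close> and the first for odd \<open>c\<close>, with the same result in terms of
  \<open>pk\<close>.\<close>

lemma compat_fps_pk:
  assumes \<sigma>: "\<sigma> permutes {1..n}" and n: "1 \<le> n"
  shows "2 * ((1 - fps_X) ^ (n + 1) * bisect (compat_fps n \<sigma> odd)) =
      (1 + fps_X) ^ (n - 1 - 2 * pk n \<sigma>) * (4 * fps_X) ^ (pk n \<sigma> + 1)"
    and "2 * pk n \<sigma> \<le> n - 1"
proof -
  define c where "c = changes False (ascent \<sigma>) n"
  define k where "k = pk n \<sigma>"
  have k: "k = c div 2" using pk_eq_changes_div_2[OF assms] by (simp add: c_def k_def)
  have "c < n" using changes_less[OF n] by (simp add: c_def)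
  then show "2 * pk n \<sigma> \<le> n - 1" using k unfolding k_def by linarith
  have odd: "odd = (\<lambda>v::nat. even v \<longleftrightarrow> False)" by auto
  have z: "(1 - fps_X\<^sup>2) ^ n * even_geom ^ n = 1"
    by (simp add: power_mult_distrib[symmetric] one_minus_X2_even_geom)
  define S where "S = compat_fps n \<sigma> odd"
  have S: "(1 - fps_X) * S = fps_X * (1 + fps_X) * alt_fps n c"
    unfolding S_def odd compat_fps_alternating[OF n] c_def ..
  have "2 * ((1 - fps_X\<^sup>2) ^ (n + 1) * S) = 2 * ((1 - fps_X\<^sup>2) ^ n * (1 + fps_X) * ((1 - fps_X) * S))"
    by (simp add: algebra_simps power2_eq_square)
  also have "\<dots> = ((1 - fps_X\<^sup>2) ^ n * even_geom ^ n) *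
      ((2 * fps_X) ^ c * ((2 * fps_X) * (1 + fps_X\<^sup>2) + 4 * fps_X\<^sup>2) * (1 + fps_X\<^sup>2) ^ (n - 1 - c))"
    unfolding S alt_fps_def by (simp add: algebra_simps power2_eq_square)
  finally have S2: "2 * ((1 - fps_X\<^sup>2) ^ (n + 1) * S) =
      (2 * fps_X) ^ c * ((2 * fps_X) * (1 + fps_X\<^sup>2) + 4 * fps_X\<^sup>2) * (1 + fps_X\<^sup>2) ^ (n - 1 - c)"
    unfolding z by simp
  have sq: "(2 * fps_X) ^ (2 * m) = (4 * fps_X\<^sup>2 :: rat fps) ^ m" for m
    by (simp add: power_mult power_mult_distrib)
  have ring: "a * (2 * x * (1 + x\<^sup>2) + 4 * x\<^sup>2) * b =
      2 * ((1 + x\<^sup>2) * b * (a * x)) + b * (4 * x\<^sup>2 * a * 1)" for a b x :: "rat fps"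
    by (simp add: algebra_simps power2_eq_square)
  have ring': "a * (2 * x) * (2 * x * (1 + x\<^sup>2) + 4 * x\<^sup>2) * b =
      (1 + x\<^sup>2) * b * (4 * x\<^sup>2 * a * 1) + 2 * (b * (4 * x\<^sup>2 * a * x))" for a b x :: "rat fps"
    by (simp add: algebra_simps power2_eq_square)
  have bis_X: "bisect fps_X = 0" by (rule bisect_parity) (auto simp: has_parity_def)
  have bis_1: "bisect 1 = 1" by (rule fps_ext) simp
  have bis: "bisect ((1 + fps_X\<^sup>2) ^ i * ((4 * fps_X\<^sup>2) ^ j * f)) =
      (1 + fps_X) ^ i * ((4 * fps_X) ^ j * bisect f)" for i j f
    by (simp only: bisect_pow_one_plus bisect_pow_four_X2)
  have two: "bisect (2 * f) = 2 * bisect f" for f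
    by (rule fps_ext) (simp add: numeral_fps_const)
  have "2 * ((1 - fps_X) ^ (n + 1) * bisect S) = bisect (2 * ((1 - fps_X\<^sup>2) ^ (n + 1) * S))"
    by (simp only: two bisect_pow_one_minus)
  also have "\<dots> = (1 + fps_X) ^ (n - 1 - 2 * k) * (4 * fps_X) ^ (k + 1)"
  proof (cases "even c")
    case True
    then have c: "c = 2 * k" using k by simp
    have "2 * ((1 - fps_X\<^sup>2) ^ (n + 1) * S) =
        2 * ((1 + fps_X\<^sup>2) ^ (n - c) * ((4 * fps_X\<^sup>2) ^ k * fps_X)) +
        (1 + fps_X\<^sup>2) ^ (n - 1 - c) * ((4 * fps_X\<^sup>2) ^ (k + 1) * 1)"
    proof -
      have "n - c = Suc (n - 1 - c)" using \<open>c < n\<close> by simp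
      moreover have "(2 * fps_X) ^ c = (4 * fps_X\<^sup>2 :: rat fps) ^ k" by (simp only: c sq)
      ultimately show ?thesis unfolding S2 by (simp only: ring power_Suc Suc_eq_plus1[symmetric])
    qed
    then show ?thesis by (simp only: bisect_add two bis bis_X bis_1) (simp add: c)
  next
    case False
    then have c: "c = 2 * k + 1" using k by presburger
    have "2 * ((1 - fps_X\<^sup>2) ^ (n + 1) * S) =
        (1 + fps_X\<^sup>2) ^ (n - c) * ((4 * fps_X\<^sup>2) ^ (k + 1) * 1) +
        2 * ((1 + fps_X\<^sup>2) ^ (n - 1 - c) * ((4 * fps_X\<^sup>2) ^ (k + 1) * fps_X))"
    proof -
      have "n - c = Suc (n - 1 - c)" using \<open>c < n\<close> by simp
      moreover have "(2 * fps_X) ^ c = (4 * fps_X\<^sup>2 :: rat fps) ^ k * (2 * fps_X)"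
        by (simp only: c sq power_add power_one_right)
      ultimately show ?thesis unfolding S2 by (simp only: ring' power_Suc Suc_eq_plus1[symmetric])
    qed
    then show ?thesis by (simp only: bisect_add two bis bis_X bis_1) (simp add: c)
  qed
  finally show "2 * ((1 - fps_X) ^ (n + 1) * bisect (compat_fps n \<sigma> odd)) =
      (1 + fps_X) ^ (n - 1 - 2 * pk n \<sigma>) * (4 * fps_X) ^ (pk n \<sigma> + 1)"
    unfolding S_def k_def .
qed

subsection \<open>Evaluation of the Cauchy products\<close>

text \<open>A positive letter may occur any number of times, a negative one at most once.\<close>

definition letter_fps :: "bool \<Rightarrow> rat fps" where
  "letter_fps r = (if r then geom else 1 + fps_X)"

text \<open>Sequences compatible with \<open>id\<close> are multisets with restricted
  multiplicities, so the letters contribute independent factors; the induction adds the largest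
  letter.\<close>

lemma card_compat_id:
  "of_nat (card (compat n id R q)) = (\<Prod>v<q. letter_fps (R v)) $ n"
proof -
  define M where "M q = Abs_fps (\<lambda>n. of_nat (card (compat n id R q)) :: rat)" for q
  have "M q = (\<Prod>v<q. letter_fps (R v))"
  proof (induction q)
    case 0
    have "compat n id R 0 = {}" if "n \<noteq> 0" for n using that by (auto simp: compat_def PiE_iff)
    then have "M 0 $ n = 1 $ n" for n by (cases "n = 0") (simp_all add: M_def)
    then show ?case by (simp add: fps_eq_iff)
  next
    case (Suc q)
    let ?e = "ending_count (\<lambda>_. True) R"
    define E where "E = Abs_fps (\<lambda>n. of_nat (?e n q) :: rat)"
    have c: "card (compat n id R m) = (if n = 0 then 1 else \<Sum>v<m. ?e n v)" for n m
      by (cases "n = 0") (simp_all add: card_compat)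
    have M': "M (Suc q) = M q + E"
      by (rule fps_ext) (simp add: M_def E_def c)
    \<comment> \<open>\<open>E\<close> counts the sequences ending in \<open>q\<close>. Without that
      last letter they use smaller letters only, or still end in \<open>q\<close> if
      \<open>q\<close> is positive.\<close>
    have E: "E = fps_X * (M q + (if R q then E else 0))"
    proof (rule fps_ext)
      fix n
      show "E $ n = (fps_X * (M q + (if R q then E else 0))) $ n"
      proof (cases n)
        case (Suc k)
        then show ?thesis by (cases k) (simp_all add: M_def E_def c)
      qed (simp add: E_def)
    qed
    have "M (Suc q) = M q * letter_fps (R q)"
    proof (cases "R q")
      case True
      then have "(1 - fps_X) * M (Suc q) = M q" using E unfolding M' by (simp add: algebra_simps)
      then have "(1 - fps_X) * M (Suc q) = (1 - fps_X) * (M q * geom)"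
        using geom_mult by (metis mult.commute mult.left_commute mult.right_neutral)
      then have "M (Suc q) = M q * geom"
        by (simp only: mult_cancel_left one_minus_X_nonzero) simp
      then show ?thesis using True by (simp add: letter_fps_def)
    next
      case False
      then show ?thesis using E unfolding M' by (simp add: letter_fps_def algebra_simps)
    qed
    then show ?case using Suc by simp
  qed
  then show ?thesis by (metis M_def fps_nth_Abs_fps)
qed

lemma prod_signs_agree:
  "(\<Prod>v<k * p. letter_fps (signs_agree P Q p v)) = (\<Prod>b<k. \<Prod>a<p. letter_fps (P b \<longleftrightarrow> Q a))"
proof -
  have "(\<Prod>v\<in>{b * p..<b * p + p}. letter_fps (signs_agree P Q p v)) =
      (\<Prod>a<p. letter_fps (P b \<longleftrightarrow> Q a))" for b
  proof (rule prod.reindex_bij_witness[of _ "pair_letter P p b" "snd_letter P p"])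
    fix v assume v: "v \<in> {b * p..<b * p + p}"
    then have p: "0 < p" by auto
    have "v div p = b" using v by (intro div_nat_eqI) (auto simp: algebra_simps)
    then show "pair_letter P p b (snd_letter P p v) = v" "snd_letter P p v \<in> {..<p}"
      "letter_fps (P b \<longleftrightarrow> Q (snd_letter P p v)) = letter_fps (signs_agree P Q p v)"
      using p pair_letter_collapse[OF p, of P v] by (auto simp: signs_agree_def)
  next
    fix a assume "a \<in> {..<p}"
    then have "a < p" by simp
    then show "snd_letter P p (pair_letter P p b a) = a" by (rule snd_pair_letter)
    show "pair_letter P p b a \<in> {b * p..<b * p + p}"
      using \<open>a < p\<close> by (auto simp: pair_letter_def)
  qed
  then show ?thesis by (simp add: prod.nat_group[symmetric])
qed

lemma sum_compat_fps:
  "(\<Sum>\<pi> | \<pi> permutes {1..n}. compat_fps n \<pi> P $ k * compat_fps n (inv \<pi>) Q $ p) =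
     (\<Prod>b<k. \<Prod>a<p. letter_fps (P b \<longleftrightarrow> Q a)) $ n"
proof -
  have "(\<Sum>\<pi> | \<pi> permutes {1..n}. compat_fps n \<pi> P $ k * compat_fps n (inv \<pi>) Q $ p) =
      of_nat (\<Sum>\<pi> | \<pi> permutes {1..n}. card (compat n \<pi> P k) * card (compat n (inv \<pi>) Q p))"
    by (simp add: compat_fps_def)
  then show ?thesis
    unfolding sum_card_compat card_compat_id prod_signs_agree .
qed

definition ratio_fps :: "rat fps" where
  "ratio_fps = (1 + fps_X) * geom"

lemma ratio_fps_mult: "ratio_fps * (1 - fps_X) = 1 + fps_X"
  using geom_mult by (simp add: ratio_fps_def mult.assoc)

text \<open>Of the letters \<open>2 * i\<close> and \<open>2 * i + 1\<close> exactly one agrees with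
  the sign \<open>r\<close>, so each such pair contributes \<open>ratio_fps\<close> for either
  \<open>r\<close>.\<close>

lemma prod_letter_fps_odd: "(\<Prod>a<2 * j. letter_fps (r \<longleftrightarrow> odd a)) = ratio_fps ^ j"
proof (induction j)
  case (Suc j)
  then show ?case by (cases r) (simp_all add: letter_fps_def ratio_fps_def mult_ac)
qed simp

text \<open>The product does not depend on the signs of the first alphabet, so its two sign patterns
  contribute equally: hence the factor 2.\<close>

lemma sum_br_ipk_coeff:
  "(\<Sum>\<pi> | \<pi> permutes {1..n}. (compat_fps n \<pi> even + compat_fps n \<pi> odd) $ k *
      bisect (compat_fps n (inv \<pi>) odd) $ j) = 2 * (ratio_fps ^ (k * j)) $ n"
proof -
  have "(\<Sum>\<pi> | \<pi> permutes {1..n}. compat_fps n \<pi> P $ k * compat_fps n (inv \<pi>) odd $ (2 * j)) =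
      (ratio_fps ^ (k * j)) $ n" for P
    unfolding sum_compat_fps prod_letter_fps_odd by (simp add: power_mult[symmetric] mult.commute)
  from this[of even] this[of odd] show ?thesis
    by (simp add: distrib_right sum.distrib)
qed

text \<open>This is the mean over the two sign patterns of the first alphabet. For even
  \<open>k\<close> the signs balance; for odd \<open>k\<close> one letter remains, positive in one
  pattern and negative in the other.\<close>

definition br_ides_fps :: "nat \<Rightarrow> nat \<Rightarrow> rat fps" where
  "br_ides_fps k j = ratio_fps ^ (k div 2 * j) *
     (if even k then 1 else fps_const (1 / 2) * (geom ^ j + (1 + fps_X) ^ j))"

lemma prod_alternating:
  fixes u v :: "'a::comm_monoid_mult"
  shows "(\<Prod>b<2 * i. if even b then u else v) = (u * v) ^ i"
  by (induction i) (simp_all add: mult_ac)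

lemma sum_br_ides_coeff:
  "(\<Sum>\<pi> | \<pi> permutes {1..n}. (compat_fps n \<pi> even + compat_fps n \<pi> odd) $ k *
      compat_fps n (inv \<pi>) (\<lambda>_. True) $ j) = 2 * br_ides_fps k j $ n"
proof -
  define u v where "u = geom ^ j" and "v = (1 + fps_X :: rat fps) ^ j"
  have uv: "u * v = ratio_fps ^ j" by (simp add: u_def v_def ratio_fps_def power_mult_distrib mult.commute)
  have half: "2 * (fps_const (1 / 2) * f) = f" for f :: "rat fps"
    by (simp add: fps_eq_iff numeral_fps_const)
  have e: "(\<Prod>a<j. letter_fps (even b \<longleftrightarrow> True)) = (if even b then u else v)"
    and o: "(\<Prod>a<j. letter_fps (odd b \<longleftrightarrow> True)) = (if even b then v else u)" for b :: nat
    by (simp_all add: letter_fps_def u_def v_def)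
  have "(\<Prod>b<k. if even b then u else v) + (\<Prod>b<k. if even b then v else u) = 2 * br_ides_fps k j"
  proof (cases "even k")
    case True
    then obtain i where k: "k = 2 * i" by (elim evenE)
    show ?thesis unfolding k prod_alternating
      by (simp add: br_ides_fps_def uv mult.commute[of v u] power_mult[symmetric] mult.commute)
  next
    case False
    then obtain i where k: "k = Suc (2 * i)" by (auto elim: oddE)
    have "(\<Prod>b<k. if even b then u else v) + (\<Prod>b<k. if even b then v else u) = (u * v) ^ i * (u + v)"
      unfolding k prod.lessThan_Suc prod_alternating by (simp add: algebra_simps)
    also have "\<dots> = 2 * br_ides_fps k j"
      using half[of "u + v"] unfolding uv
      by (simp add: k br_ides_fps_def power_mult[symmetric] mult.commute[of i] mult.left_commute[of 2] flip: u_def v_def)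
    finally show ?thesis .
  qed
  then have "((\<Prod>b<k. if even b then u else v) + (\<Prod>b<k. if even b then v else u)) $ n =
      2 * br_ides_fps k j $ n"
    by (simp add: numeral_fps_const)
  then show ?thesis
    using sum_compat_fps[of n even k "\<lambda>_. True" j] sum_compat_fps[of n odd k "\<lambda>_. True" j]
    unfolding e o by (simp add: distrib_right sum.distrib)
qed

text \<open>Coefficients of order 0 and 1 are needed because the sum over \<open>n\<close> starts at
  2 and the two explicit terms must supply the lower orders.\<close>

lemma fps_power_nth_1: "f $ 0 = 1 \<Longrightarrow> (f ^ m) $ 1 = of_nat m * (f $ 1 :: rat)"
  by (induction m) (simp_all add: fps_mult_nth_1 fps_power_zeroth algebra_simps)

lemma ratio_fps_nth: "ratio_fps $ 0 = 1" "ratio_fps $ 1 = 2"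
  by (simp_all add: ratio_fps_def geom_def fps_mult_nth_1)

lemma ratio_fps_power_nth: "(ratio_fps ^ m) $ 0 = 1" "(ratio_fps ^ m) $ 1 = 2 * of_nat m"
  using fps_power_nth_1[OF ratio_fps_nth(1), of m] unfolding ratio_fps_nth(2)
  by (simp_all add: fps_power_zeroth ratio_fps_nth(1))

lemma br_ides_fps_nth: "br_ides_fps k j $ 0 = 1" "br_ides_fps k j $ 1 = of_nat k * of_nat j"
proof -
  have g: "(geom ^ j) $ 0 = 1" "(geom ^ j) $ 1 = of_nat j"
    using fps_power_nth_1[of geom j] by (simp_all add: geom_def fps_power_zeroth)
  have x: "((1 + fps_X :: rat fps) ^ j) $ 0 = 1" "((1 + fps_X :: rat fps) ^ j) $ 1 = of_nat j"
    using fps_power_nth_1[of "1 + fps_X" j] by (simp_all add: fps_power_zeroth)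
  show "br_ides_fps k j $ 0 = 1"
    using g(1) x(1) by (simp add: br_ides_fps_def ratio_fps_power_nth)
  show "br_ides_fps k j $ 1 = of_nat k * of_nat j"
  proof (cases "even k")
    case True
    then show ?thesis by (auto simp: br_ides_fps_def ratio_fps_power_nth[unfolded One_nat_def] elim!: evenE)
  next
    case False
    then obtain i where k: "k = Suc (2 * i)" by (auto elim: oddE)
    show ?thesis
      using g x by (simp only: br_ides_fps_def fps_mult_nth_1 fps_mult_left_const_nth) (simp add: k ratio_fps_power_nth[unfolded One_nat_def] algebra_simps)
  qed
qed

subsection \<open>Power series in three variables\<close>

text \<open>This moves the variable of a series one level outward. In the iterated type
  \<open>s\<close> is innermost and \<open>x\<close> outermost, so the three lifts below embed
  one-variable series in \<open>s\<close>, \<open>t\<close> and \<open>x\<close>.\<close>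

definition map_const :: "'a::comm_ring_1 fps \<Rightarrow> 'a fps fps" where
  "map_const f = Abs_fps (\<lambda>j. fps_const (f $ j))"

lemma map_const_nth [simp]: "map_const f $ j = fps_const (f $ j)"
  by (simp add: map_const_def)

lemma map_const_simps:
  "map_const 0 = 0" "map_const 1 = 1" "map_const fps_X = fps_X"
  "map_const (f + g) = map_const f + map_const g"
  "map_const (f - g) = map_const f - map_const g"
  "map_const (f * g) = map_const f * map_const g"
proof -
  show "map_const (f * g) = map_const f * map_const g"
    by (intro fps_ext) (simp add: fps_mult_nth fps_sum_nth)
qed (auto intro!: fps_ext)

definition lift_s :: "rat fps \<Rightarrow> fps3" where
  "lift_s f = fps_const (fps_const f)"

definition lift_t :: "rat fps \<Rightarrow> fps3" where
  "lift_t f = fps_const (map_const f)"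

definition lift_x :: "rat fps \<Rightarrow> fps3" where
  "lift_x f = map_const (map_const f)"

lemma lift_s_hom:
  "lift_s 1 = 1" "lift_s fps_X = var_s" "lift_s (f + g) = lift_s f + lift_s g"
  "lift_s (f - g) = lift_s f - lift_s g" "lift_s (f * g) = lift_s f * lift_s g"
  by (simp_all add: lift_s_def var_s_def)

lemma lift_t_hom:
  "lift_t 1 = 1" "lift_t fps_X = var_t" "lift_t (f + g) = lift_t f + lift_t g"
  "lift_t (f - g) = lift_t f - lift_t g" "lift_t (f * g) = lift_t f * lift_t g"
  by (simp_all add: lift_t_def var_t_def map_const_simps)

lemma lift_x_hom:
  "lift_x 1 = 1" "lift_x fps_X = var_x" "lift_x (f + g) = lift_x f + lift_x g"
  "lift_x (f - g) = lift_x f - lift_x g" "lift_x (f * g) = lift_x f * lift_x g"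
  by (simp_all add: lift_x_def var_x_def map_const_simps)

lemma lift_power:
  "lift_s (f ^ m) = lift_s f ^ m" "lift_t (f ^ m) = lift_t f ^ m" "lift_x (f ^ m) = lift_x f ^ m"
  by (induction m) (simp_all add: lift_s_hom lift_t_hom lift_x_hom)

lemma lift_numeral:
  "lift_s (numeral m) = numeral m" "lift_t (numeral m) = numeral m" "lift_x (numeral m) = numeral m"
  by (induction m) (simp_all only: numeral.simps lift_s_hom lift_t_hom lift_x_hom)

lemmas lift_simps = lift_s_hom lift_t_hom lift_x_hom lift_power lift_numeral

lemma coeff3_lift: "coeff3 (lift_s f * lift_t g * lift_x h) a b c = f $ a * g $ b * h $ c"
  by (simp add: coeff3_def lift_s_def lift_t_def lift_x_def mult.assoc)

lemma coeff3_ext: "(\<And>a b c. coeff3 F a b c = coeff3 G a b c) \<Longrightarrow> F = G"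
  by (intro fps_ext) (simp add: coeff3_def)

lemma coeff3_add: "coeff3 (F + G) a b c = coeff3 F a b c + coeff3 G a b c"
  by (simp add: coeff3_def)

lemma coeff3_sum: "coeff3 (sum F I) a b c = (\<Sum>i\<in>I. coeff3 (F i) a b c)"
  by (simp add: coeff3_def fps_sum_nth)

lemma coeff3_0:
  "coeff3 (F * G) 0 0 0 = coeff3 F 0 0 0 * coeff3 G 0 0 0"
  "coeff3 (F + G) 0 0 0 = coeff3 F 0 0 0 + coeff3 G 0 0 0"
  "coeff3 (F - G) 0 0 0 = coeff3 F 0 0 0 - coeff3 G 0 0 0"
  "coeff3 (F ^ m) 0 0 0 = coeff3 F 0 0 0 ^ m"
  "coeff3 1 0 0 0 = 1" "coeff3 (numeral w) 0 0 0 = numeral w"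
  "coeff3 var_s 0 0 0 = 0" "coeff3 var_t 0 0 0 = 0" "coeff3 var_x 0 0 0 = 0"
  by (simp_all add: coeff3_def fps_power_zeroth var_s_def var_t_def var_x_def)

lemma fps3_divide_eqI:
  assumes "coeff3 G 0 0 0 \<noteq> 0" "H * G = F"
  shows "F / G = H"
proof -
  have "F / G * G = H * G" using fps3_divide_mult[OF assms(1)] assms(2) by simp
  moreover have "G \<noteq> 0" using assms(1) by (auto simp: coeff3_def)
  ultimately show ?thesis by simp
qed

section \<open>Formal sums in which each monomial comes from one summand\<close>

lemma formal_sum_monomials:
  fixes c :: "nat \<Rightarrow> rat fps fps"
  assumes f: "\<And>n. n \<in> I \<Longrightarrow> f n = fps_const (c n) * fps_X ^ n"
  shows "formal_summable f I" and "formal_sum f I = Abs_fps (\<lambda>n. if n \<in> I then c n else 0)"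
proof -
  have co: "coeff3 (f n) k j m = (if n = m then c n $ j $ k else 0)" if "n \<in> I" for n k j m
    using f[OF that] by (simp add: coeff3_def)
  have "{n \<in> I. coeff3 (f n) k j m \<noteq> 0} \<subseteq> {m}" for k j m
    by (auto simp: co split: if_splits)
  then have "finite {n \<in> I. coeff3 (f n) k j m \<noteq> 0}" for k j m
    by (rule finite_subset) simp
  then show "formal_summable f I" unfolding formal_summable_def by blast
  have "(\<Sum>n | n \<in> I \<and> coeff3 (f n) k j m \<noteq> 0. coeff3 (f n) k j m) = (if m \<in> I then c m $ j $ k else 0)"
    for k j m
  proof (cases "m \<in> I \<and> c m $ j $ k \<noteq> 0")
    case True
    then have "{n. n \<in> I \<and> coeff3 (f n) k j m \<noteq> 0} = {m}" by (auto simp: co split: if_splits)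
    then show ?thesis using True by (simp add: co)
  next
    case False
    then have "{n. n \<in> I \<and> coeff3 (f n) k j m \<noteq> 0} = {}" by (auto simp: co split: if_splits)
    then have "(\<Sum>n | n \<in> I \<and> coeff3 (f n) k j m \<noteq> 0. coeff3 (f n) k j m) = 0" by (simp only: sum.empty)
    then show ?thesis using False by auto
  qed
  then show "formal_sum f I = Abs_fps (\<lambda>n. if n \<in> I then c n else 0)"
    unfolding formal_sum_def by (intro fps_ext) simp
qed

text \<open>This fits families whose member \<open>(i, j)\<close> contains only monomials with
  \<open>s\<close>-exponent \<open>2 * i\<close> or \<open>2 * i + 1\<close> and
  \<open>t\<close>-exponent \<open>j\<close>, so that no two members share a monomial.\<close>

lemma formal_sum_bidegree:
  fixes f :: "nat \<times> nat \<Rightarrow> fps3"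
  assumes co: "\<And>i j a b c. coeff3 (f (i, j)) a b c = (if i = a div 2 \<and> j = b then r a b c else 0)"
  shows "formal_summable f UNIV" and "coeff3 (formal_sum f UNIV) a b c = r a b c"
proof -
  have sub: "{x \<in> UNIV. coeff3 (f x) a b c \<noteq> 0} = (if r a b c = 0 then {} else {(a div 2, b)})" for a b c
    using co by (auto split: if_splits)
  then show "formal_summable f UNIV" by (simp add: formal_summable_def)
  show "coeff3 (formal_sum f UNIV) a b c = r a b c"
    unfolding formal_sum_def using sub[of a b c] co[of "a div 2" b a b c] by (simp add: coeff3_def)
qed

lemma linear_fps_mult: "Abs_fps of_nat * (1 - fps_X)\<^sup>2 = (fps_X :: rat fps)"
proof -
  have "Abs_fps of_nat * (1 - fps_X) = fps_X * geom"
  proof (rule fps_ext)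
    fix n
    show "(Abs_fps of_nat * (1 - fps_X)) $ n = (fps_X * geom) $ n"
      by (cases n) (auto simp: right_diff_distrib geom_def)
  qed
  then have "Abs_fps of_nat * (1 - fps_X)\<^sup>2 = fps_X * (geom * (1 - fps_X))"
    by (simp add: power2_eq_square mult.assoc[symmetric])
  then show ?thesis by (simp add: geom_mult)
qed

section \<open>The explicit terms and the summands over \<open>n\<close>\<close>

lemma divide_constant_term:
  "1 / ((1 - var_s) * (1 - var_t)) = lift_s geom * lift_t geom * lift_x 1"
proof (rule fps3_divide_eqI)
  have "lift_s geom * lift_t geom * lift_x 1 * ((1 - var_s) * (1 - var_t)) =
      lift_s (geom * (1 - fps_X)) * lift_t (geom * (1 - fps_X))"
    by (simp add: lift_simps mult_ac)
  then show "lift_s geom * lift_t geom * lift_x 1 * ((1 - var_s) * (1 - var_t)) = 1"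
    by (simp add: geom_mult lift_simps)
qed (simp add: coeff3_0)

lemma divide_linear_term:
  assumes "z = lift_x w"
  shows "z * var_s * var_t * var_x / ((1 - var_s)\<^sup>2 * (1 - var_t)\<^sup>2) =
    lift_s (Abs_fps of_nat) * lift_t (Abs_fps of_nat) * lift_x (w * fps_X)"
proof (rule fps3_divide_eqI)
  have "lift_s (Abs_fps of_nat) * lift_t (Abs_fps of_nat) * lift_x (w * fps_X) *
      ((1 - var_s)\<^sup>2 * (1 - var_t)\<^sup>2) =
    lift_s (Abs_fps of_nat * (1 - fps_X)\<^sup>2) * lift_t (Abs_fps of_nat * (1 - fps_X)\<^sup>2) * lift_x (w * fps_X)"
    by (simp add: lift_simps mult_ac)
  then show "lift_s (Abs_fps of_nat) * lift_t (Abs_fps of_nat) * lift_x (w * fps_X) *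
      ((1 - var_s)\<^sup>2 * (1 - var_t)\<^sup>2) = z * var_s * var_t * var_x"
    by (simp add: linear_fps_mult lift_simps assms mult_ac)
qed (simp add: coeff3_0)

text \<open>Since \<open>br n \<pi> \<le> n - 1\<close>, the power of
  \<open>1 + var_s\<^sup>2\<close> absorbs all denominators and leaves the polynomial of
  \<open>compat_fps_br\<close>.\<close>

lemma br_term_eq:
  assumes \<pi>: "\<pi> permutes {1..n}" and n: "2 \<le> n"
  shows "(1 + var_s) ^ 3 * ((1 + var_s\<^sup>2) ^ (n - 1) * (2 * var_s / (1 + var_s\<^sup>2)) ^ br n \<pi>) =
    2 * ((1 - var_s) * (1 - var_s\<^sup>2) ^ n * lift_s (compat_fps n \<pi> even + compat_fps n \<pi> odd))"
proof -
  let ?u = "2 * var_s / (1 + var_s\<^sup>2)"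
  have u: "(1 + var_s\<^sup>2) * ?u = 2 * var_s"
    using fps3_divide_mult[of "1 + var_s\<^sup>2" "2 * var_s"] by (simp add: coeff3_0 mult.commute)
  have "n - 1 = (n - 1 - br n \<pi>) + br n \<pi>" using compat_fps_br(2)[OF assms] by simp
  then have "(1 + var_s\<^sup>2) ^ (n - 1) = (1 + var_s\<^sup>2) ^ (n - 1 - br n \<pi>) * (1 + var_s\<^sup>2) ^ br n \<pi>"
    by (metis power_add)
  then have "(1 + var_s\<^sup>2) ^ (n - 1) * ?u ^ br n \<pi> =
      (1 + var_s\<^sup>2) ^ (n - 1 - br n \<pi>) * ((1 + var_s\<^sup>2) * ?u) ^ br n \<pi>"
    by (simp only: power_mult_distrib mult.assoc)
  then show ?thesis
    unfolding u using arg_cong[OF compat_fps_br(1)[OF assms], of lift_s] by (simp add: lift_simps)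
qed

text \<open>Since \<open>2 * (ipk n \<pi> + 1) \<le> n + 1\<close>, the power of
  \<open>1 + var_t\<close> absorbs the squared denominators and leaves the polynomial of
  \<open>compat_fps_pk\<close> for \<open>inv \<pi>\<close>.\<close>

lemma ipk_term_eq:
  assumes \<pi>: "\<pi> permutes {1..n}" and n: "1 \<le> n"
  shows "(1 + var_t) ^ (n + 1) * (4 * var_t / (1 + var_t)\<^sup>2) ^ (ipk n \<pi> + 1) =
    2 * ((1 - var_t) ^ (n + 1) * lift_t (bisect (compat_fps n (inv \<pi>) odd)))"
proof -
  let ?v = "4 * var_t / (1 + var_t)\<^sup>2" and ?k = "ipk n \<pi>"
  note pk = compat_fps_pk[OF permutes_inv[OF \<pi>] n, folded ipk_def]
  have v: "(1 + var_t)\<^sup>2 * ?v = 4 * var_t"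
    using fps3_divide_mult[of "(1 + var_t)\<^sup>2" "4 * var_t"] by (simp add: coeff3_0 mult.commute)
  have "n + 1 = (n - 1 - 2 * ?k) + 2 * (?k + 1)" using pk(2) n by simp
  then have "(1 + var_t) ^ (n + 1) = (1 + var_t) ^ (n - 1 - 2 * ?k) * ((1 + var_t)\<^sup>2) ^ (?k + 1)"
    by (metis power_add power_mult)
  then have "(1 + var_t) ^ (n + 1) * ?v ^ (?k + 1) =
      (1 + var_t) ^ (n - 1 - 2 * ?k) * ((1 + var_t)\<^sup>2 * ?v) ^ (?k + 1)"
    by (simp only: power_mult_distrib mult.assoc)
  also have "\<dots> = lift_t ((1 + fps_X) ^ (n - 1 - 2 * ?k) * (4 * fps_X) ^ (?k + 1))"
    unfolding v by (simp only: lift_simps)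
  also have "\<dots> = 2 * ((1 - var_t) ^ (n + 1) * lift_t (bisect (compat_fps n (inv \<pi>) odd)))"
    unfolding pk(1)[symmetric] by (simp only: lift_simps)
  finally show ?thesis .
qed

lemma ides_term_eq:
  assumes \<pi>: "\<pi> permutes {1..n}" and n: "1 \<le> n"
  shows "var_t ^ (ides n \<pi> + 1) = (1 - var_t) ^ (n + 1) * lift_t (compat_fps n (inv \<pi>) (\<lambda>_. True))"
  using arg_cong[OF compat_fps_all_positive[OF permutes_inv[OF \<pi>] n, folded ides_def], of lift_t]
  by (simp only: lift_simps)

text \<open>The series in \<open>s\<close> and \<open>t\<close> whose coefficient at
  \<open>s^k t^j\<close> is the \<open>x^n\<close>-coefficient of \<open>R k j\<close>.\<close>

definition coeff_array :: "(nat \<Rightarrow> nat \<Rightarrow> rat fps) \<Rightarrow> nat \<Rightarrow> rat fps fps" where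
  "coeff_array R n = Abs_fps (\<lambda>j. Abs_fps (\<lambda>k. R k j $ n))"

lemma sum_lift_eq_coeff_array:
  assumes "\<And>k j. (\<Sum>\<pi>\<in>A. S \<pi> $ k * T \<pi> $ j) = 2 * R k j $ n"
  shows "(\<Sum>\<pi>\<in>A. lift_s (S \<pi>) * lift_t (T \<pi>)) = 2 * fps_const (coeff_array R n)"
proof (rule coeff3_ext)
  fix a b c
  have "coeff3 (\<Sum>\<pi>\<in>A. lift_s (S \<pi>) * lift_t (T \<pi>)) a b c =
      (\<Sum>\<pi>\<in>A. coeff3 (lift_s (S \<pi>) * lift_t (T \<pi>) * lift_x 1) a b c)"
    by (simp add: coeff3_sum lift_simps)
  also have "\<dots> = (\<Sum>\<pi>\<in>A. S \<pi> $ a * T \<pi> $ b) * (1 :: rat fps) $ c"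
    by (simp only: coeff3_lift sum_distrib_right)
  also have "\<dots> = coeff3 (2 * fps_const (coeff_array R n)) a b c"
    unfolding assms mult_2 coeff3_add by (simp add: coeff3_def coeff_array_def)
  finally show "coeff3 (\<Sum>\<pi>\<in>A. lift_s (S \<pi>) * lift_t (T \<pi>)) a b c =
      coeff3 (2 * fps_const (coeff_array R n)) a b c" .
qed

text \<open>\<open>l\<close> is the inverse of the prefactor
  \<open>(1 + s)^3 / (q * (1 - s))\<close>. The quotient is identified after multiplication by
  \<open>2 * (1 + s)^3\<close>, which can be cancelled.\<close>

lemma lhs_term_eq:
  assumes l: "l * (1 + fps_X) ^ 3 = numeral q * (1 - fps_X)"
    and D: "coeff3 D 0 0 0 \<noteq> 0"
    and A: "2 * ((1 + var_s) ^ 3 * A) = numeral q * (1 - var_s) * (D * (2 * fps_const C))"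
  shows "A / D = lift_s l * fps_const C"
proof (rule fps3_divide_eqI[OF D])
  have "(1 + var_s) ^ 3 * (lift_s l * fps_const C * D) = lift_s (l * (1 + fps_X) ^ 3) * fps_const C * D"
    by (simp add: lift_simps mult_ac)
  also have "\<dots> = numeral q * (1 - var_s) * fps_const C * D"
    unfolding l by (simp add: lift_simps)
  finally have e: "(1 + var_s) ^ 3 * (lift_s l * fps_const C * D) = numeral q * (1 - var_s) * fps_const C * D" .
  have "2 * ((1 + var_s) ^ 3 * (lift_s l * fps_const C * D)) = 2 * ((1 + var_s) ^ 3 * A)"
    unfolding A e by (simp only: mult_ac)
  moreover have "coeff3 ((1 + var_s) ^ 3) 0 0 0 \<noteq> 0" by (simp add: coeff3_0)
  then have "(1 + var_s) ^ 3 \<noteq> 0" by (auto simp: coeff3_def)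
  ultimately show "lift_s l * fps_const C * D = A" by simp
qed

text \<open>The explicit terms supply the orders 0 and 1 in \<open>x\<close>, the formal sum all
  higher ones, so a single family \<open>R\<close> describes every coefficient. It is applied with
  \<open>q\<close> equal to 8 or 4 and \<open>v\<close> equal to 2 or 1.\<close>

lemma coeff3_identity_lhs:
  assumes lhs: "\<And>n. 2 \<le> n \<Longrightarrow> lhs n = lift_s l * fps_const (coeff_array R n) * var_x ^ n"
    and l: "l * (1 + fps_X) ^ 3 = numeral q * (1 - fps_X)"
    and z: "z = lift_x w"
    and w: "w = fps_const v"
    and R0: "\<And>k j. R k j $ 0 = 1" and R1: "\<And>k j. R k j $ 1 = v * of_nat k * of_nat j"
  shows "formal_summable lhs {2..}"
    and "coeff3 (1 / ((1 - var_s) * (1 - var_t))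
        + z * var_s * var_t * var_x / ((1 - var_s)\<^sup>2 * (1 - var_t)\<^sup>2)
        + (1 + var_s) ^ 3 / (numeral q * (1 - var_s)) * formal_sum lhs {2..}) a b c = R a b $ c"
proof -
  have f: "lhs n = fps_const (fps_const l * coeff_array R n) * fps_X ^ n" if "n \<in> {2..}" for n
    using lhs[of n] that by (simp add: lift_s_def var_x_def)
  have fs: "formal_summable lhs {2..}"
    "formal_sum lhs {2..} = Abs_fps (\<lambda>n. if n \<in> {2..} then fps_const l * coeff_array R n else 0)"
    by (rule formal_sum_monomials, rule f, assumption)+
  show "formal_summable lhs {2..}" by (rule fs(1))
  have c0: "coeff3 (numeral q * (1 - var_s)) 0 0 0 \<noteq> 0" by (simp add: coeff3_0)
  define K where "K = (1 + var_s) ^ 3 / (numeral q * (1 - var_s))"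
  \<comment> \<open>The factor \<open>lift_s l\<close> is common to all summands; pulled out of the
    formal sum, it cancels the prefactor \<open>K\<close>.\<close>
  have "(K * lift_s l) * (numeral q * (1 - var_s)) = lift_s l * (K * (numeral q * (1 - var_s)))"
    by (simp only: mult_ac)
  also have "K * (numeral q * (1 - var_s)) = (1 + var_s) ^ 3"
    unfolding K_def by (rule fps3_divide_mult[OF c0])
  also have "lift_s l * (1 + var_s) ^ 3 = numeral q * (1 - var_s)"
    using arg_cong[OF l, of lift_s] by (simp only: lift_simps)
  finally have "(K * lift_s l) * (numeral q * (1 - var_s)) = 1 * (numeral q * (1 - var_s))" by simp
  moreover have "numeral q * (1 - var_s) \<noteq> 0" using c0 by (auto simp: coeff3_def)
  ultimately have Kl: "K * lift_s l = 1" using mult_right_cancel by blast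
  have "formal_sum lhs {2..} = lift_s l * Abs_fps (\<lambda>n. if 2 \<le> n then coeff_array R n else 0)"
    unfolding fs(2) lift_s_def by (rule fps_ext) simp
  then have "K * formal_sum lhs {2..} = Abs_fps (\<lambda>n. if 2 \<le> n then coeff_array R n else 0)"
    by (simp only: mult.assoc[symmetric] Kl mult_1)
  then have K: "coeff3 (K * formal_sum lhs {2..}) a b c = (if 2 \<le> c then R a b $ c else 0)"
    by (simp add: coeff3_def coeff_array_def)
  show "coeff3 (1 / ((1 - var_s) * (1 - var_t))
        + z * var_s * var_t * var_x / ((1 - var_s)\<^sup>2 * (1 - var_t)\<^sup>2)
        + (1 + var_s) ^ 3 / (numeral q * (1 - var_s)) * formal_sum lhs {2..}) a b c = R a b $ c"
    unfolding K_def[symmetric] coeff3_add K divide_constant_term divide_linear_term[OF z] coeff3_lift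
    using R0[of a b] R1[of a b] w
    by (cases "c = 0"; cases "c = 1") (auto simp: geom_def)
qed

lemma lift_x_ratio_fps: "(1 + var_x) / (1 - var_x) = lift_x ratio_fps"
proof (rule fps3_divide_eqI)
  show "lift_x ratio_fps * (1 - var_x) = 1 + var_x"
    using arg_cong[OF ratio_fps_mult, of lift_x] by (simp only: lift_simps)
qed (simp add: coeff3_0)

lemma lift_x_geom: "F / (1 - var_x) ^ j = F * lift_x (geom ^ j)"
proof (rule fps3_divide_eqI)
  have "lift_x geom * (1 - var_x) = 1"
    using arg_cong[OF geom_mult, of lift_x] by (simp only: lift_simps)
  then show "F * lift_x (geom ^ j) * (1 - var_x) ^ j = F"
    by (simp add: lift_simps mult.assoc power_mult_distrib[symmetric])
qed (simp add: coeff3_0)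

lemma coeff3_double: "coeff3 (2 * F) a b c = 2 * coeff3 F a b c"
  unfolding mult_2 coeff3_add by simp

text \<open>Here \<open>1 / 2\<close> is a quotient in \<open>fps3\<close>, so halving is expressed
  by doubling the other side.\<close>

lemma coeff3_half: "2 * coeff3 (1 / 2 * F) a b c = coeff3 F a b c"
proof -
  have "1 / 2 * 2 = (1 :: fps3)" by (rule fps3_divide_mult) (simp add: coeff3_0)
  then have "2 * (1 / 2 * F) = F" by (simp add: mult.assoc[symmetric] mult.commute[of 2])
  then show ?thesis by (metis coeff3_double)
qed

theorem theorem5p8:
  defines "s \<equiv> var_s" and "t \<equiv> var_t" and "x \<equiv> var_x"
  defines "lhs_a \<equiv> \<lambda>n::nat.
      (1 + s\<^sup>2) ^ (n - 1) * (1 + t) ^ (n + 1)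
        * P_br_ipk n (2 * s / (1 + s\<^sup>2)) (4 * t / (1 + t)\<^sup>2)
        / ((1 - s\<^sup>2) ^ n * (1 - t) ^ (n + 1)) * x ^ n"
  defines "rhs_a \<equiv> \<lambda>(i::nat, j::nat).
      ((1 + x) / (1 - x)) ^ (2 * i * j) * (1 + s * ((1 + x) / (1 - x)) ^ j)
        * s ^ (2 * i) * t ^ j"
  defines "lhs_b \<equiv> \<lambda>n::nat.
      (1 + s\<^sup>2) ^ (n - 1) * P_br_ides n (2 * s / (1 + s\<^sup>2)) t
        / ((1 - s\<^sup>2) ^ n * (1 - t) ^ (n + 1)) * x ^ n"
  defines "rhs_b \<equiv> \<lambda>(i::nat, j::nat).
      ((1 + x) / (1 - x)) ^ (i * j) * (2 + s / (1 - x) ^ j + s * (1 + x) ^ j)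
        * s ^ (2 * i) * t ^ j"
  shows
    "(formal_summable lhs_a {2..} \<and> formal_summable rhs_a UNIV \<and>
      1 / ((1 - s) * (1 - t)) + 2 * s * t * x / ((1 - s)\<^sup>2 * (1 - t)\<^sup>2)
        + (1 + s) ^ 3 / (8 * (1 - s)) * formal_sum lhs_a {2..}
      = formal_sum rhs_a UNIV) \<and>
     (formal_summable lhs_b {2..} \<and> formal_summable rhs_b UNIV \<and>
      1 / ((1 - s) * (1 - t)) + s * t * x / ((1 - s)\<^sup>2 * (1 - t)\<^sup>2)
        + (1 + s) ^ 3 / (4 * (1 - s)) * formal_sum lhs_b {2..}
      = 1 / 2 * formal_sum rhs_b UNIV)"
proof -
  \<comment> \<open>The two parts of the summand \<open>(i, j)\<close> on the right have exponents
    \<open>2 * i * j\<close> and \<open>(2 * i + 1) * j\<close>, that is \<open>k * j\<close> for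
    the exponent \<open>k\<close> of \<open>s\<close>.\<close>
  define R where "R k j = ratio_fps ^ (k * j)" for k j
  define la lb :: "rat fps" where
    "la = 8 * (1 - fps_X) * inverse ((1 + fps_X) ^ 3)" and
    "lb = 4 * (1 - fps_X) * inverse ((1 + fps_X) ^ 3)"
  have "inverse ((1 + fps_X) ^ 3) * (1 + fps_X) ^ 3 = (1 :: rat fps)"
    by (rule inverse_mult_eq_1) (simp add: fps_power_zeroth)
  then have la: "la * (1 + fps_X) ^ 3 = 8 * (1 - fps_X)" and lb: "lb * (1 + fps_X) ^ 3 = 4 * (1 - fps_X)"
    by (simp_all add: la_def lb_def mult.assoc)
  let ?S = "\<lambda>n \<pi>. compat_fps n \<pi> even + compat_fps n \<pi> odd"
  let ?D = "\<lambda>n. (1 - var_s\<^sup>2) ^ n * (1 - var_t) ^ (n + 1)"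
  have D: "coeff3 (?D n) 0 0 0 \<noteq> 0" for n by (simp add: coeff3_0)
  have lhs_a: "lhs_a n = lift_s la * fps_const (coeff_array R n) * var_x ^ n" if n: "2 \<le> n" for n
  proof -
    let ?T = "\<lambda>\<pi>. bisect (compat_fps n (inv \<pi>) odd)"
    define A where "A = (1 + var_s\<^sup>2) ^ (n - 1) * (1 + var_t) ^ (n + 1)
        * P_br_ipk n (2 * var_s / (1 + var_s\<^sup>2)) (4 * var_t / (1 + var_t)\<^sup>2)"
    \<comment> \<open>Distributed over the permutations, the powers make each summand a series in
      \<open>s\<close> times a series in \<open>t\<close>.\<close>
    have "(1 + var_s) ^ 3 * A = (\<Sum>\<pi> | \<pi> permutes {1..n}.
        ((1 + var_s) ^ 3 * ((1 + var_s\<^sup>2) ^ (n - 1) * (2 * var_s / (1 + var_s\<^sup>2)) ^ br n \<pi>)) *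
        ((1 + var_t) ^ (n + 1) * (4 * var_t / (1 + var_t)\<^sup>2) ^ (ipk n \<pi> + 1)))"
      unfolding A_def P_br_ipk_def sum_distrib_left by (intro sum.cong refl) (simp only: mult_ac)
    also have "\<dots> = (\<Sum>\<pi> | \<pi> permutes {1..n}.
        4 * (1 - var_s) * ?D n * (lift_s (?S n \<pi>) * lift_t (?T \<pi>)))"
    proof (intro sum.cong refl)
      fix \<pi> assume "\<pi> \<in> {\<pi>. \<pi> permutes {1..n}}"
      then have \<pi>: "\<pi> permutes {1..n}" by simp
      have "1 \<le> n" using n by simp
      note tt = br_term_eq[OF \<pi> n] ipk_term_eq[OF \<pi> this]
      have "2 * (a * b * c) * (2 * (d * e)) = 4 * a * (b * d) * (c * e)" for a b c d e :: fps3
        by (simp add: mult_ac)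
      then show "((1 + var_s) ^ 3 * ((1 + var_s\<^sup>2) ^ (n - 1) * (2 * var_s / (1 + var_s\<^sup>2)) ^ br n \<pi>)) *
        ((1 + var_t) ^ (n + 1) * (4 * var_t / (1 + var_t)\<^sup>2) ^ (ipk n \<pi> + 1)) =
        4 * (1 - var_s) * ?D n * (lift_s (?S n \<pi>) * lift_t (?T \<pi>))"
        unfolding tt .
    qed
    \<comment> \<open>The constant 8 is 2 * 2 * 2: one factor each from \<open>br_term_eq\<close>,
      \<open>ipk_term_eq\<close> and the two sign patterns.\<close>
    also have "\<dots> = 4 * (1 - var_s) * ?D n * (2 * fps_const (coeff_array R n))"
      unfolding sum_distrib_left[symmetric]
      by (subst sum_lift_eq_coeff_array[where R = R and n = n]) (simp_all only: sum_br_ipk_coeff R_def)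
    finally have "2 * ((1 + var_s) ^ 3 * A) = 8 * (1 - var_s) * (?D n * (2 * fps_const (coeff_array R n)))"
      by simp
    from lhs_term_eq[OF la D this] show ?thesis
      unfolding lhs_a_def s_def t_def x_def A_def by simp
  qed
  have lhs_b: "lhs_b n = lift_s lb * fps_const (coeff_array br_ides_fps n) * var_x ^ n" if n: "2 \<le> n" for n
  proof -
    let ?T = "\<lambda>\<pi>. compat_fps n (inv \<pi>) (\<lambda>_. True)"
    define A where "A = (1 + var_s\<^sup>2) ^ (n - 1) * P_br_ides n (2 * var_s / (1 + var_s\<^sup>2)) var_t"
    have "(1 + var_s) ^ 3 * A = (\<Sum>\<pi> | \<pi> permutes {1..n}.
        ((1 + var_s) ^ 3 * ((1 + var_s\<^sup>2) ^ (n - 1) * (2 * var_s / (1 + var_s\<^sup>2)) ^ br n \<pi>)) *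
        var_t ^ (ides n \<pi> + 1))"
      unfolding A_def P_br_ides_def sum_distrib_left by (intro sum.cong refl) (simp only: mult_ac)
    also have "\<dots> = (\<Sum>\<pi> | \<pi> permutes {1..n}.
        2 * (1 - var_s) * ?D n * (lift_s (?S n \<pi>) * lift_t (?T \<pi>)))"
    proof (intro sum.cong refl)
      fix \<pi> assume "\<pi> \<in> {\<pi>. \<pi> permutes {1..n}}"
      then have \<pi>: "\<pi> permutes {1..n}" by simp
      have "1 \<le> n" using n by simp
      note tt = br_term_eq[OF \<pi> n] ides_term_eq[OF \<pi> this]
      have "2 * (a * b * c) * (d * e) = 2 * a * (b * d) * (c * e)" for a b c d e :: fps3
        by (simp only: mult_ac)
      then show "((1 + var_s) ^ 3 * ((1 + var_s\<^sup>2) ^ (n - 1) * (2 * var_s / (1 + var_s\<^sup>2)) ^ br n \<pi>)) *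
        var_t ^ (ides n \<pi> + 1) = 2 * (1 - var_s) * ?D n * (lift_s (?S n \<pi>) * lift_t (?T \<pi>))"
        unfolding tt .
    qed
    \<comment> \<open>Here the constant is 2 * 2 = 4, because \<open>ides_term_eq\<close> brings no
      factor.\<close>
    also have "\<dots> = 2 * (1 - var_s) * ?D n * (2 * fps_const (coeff_array br_ides_fps n))"
      unfolding sum_distrib_left[symmetric]
      by (subst sum_lift_eq_coeff_array[where R = br_ides_fps and n = n]) (simp_all only: sum_br_ides_coeff)
    finally have "2 * ((1 + var_s) ^ 3 * A) = 4 * (1 - var_s) * (?D n * (2 * fps_const (coeff_array br_ides_fps n)))"
      by simp
    from lhs_term_eq[OF lb D this] show ?thesis
      unfolding lhs_b_def s_def t_def x_def A_def by simp
  qed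
  have rhs_a: "coeff3 (rhs_a (i, j)) a b c = (if i = a div 2 \<and> j = b then R a b $ c else 0)" for i j a b c
  proof -
    have "rhs_a (i, j) = lift_s (fps_X ^ (2 * i)) * lift_t (fps_X ^ j) * lift_x (ratio_fps ^ (2 * i * j)) +
        lift_s (fps_X ^ (2 * i + 1)) * lift_t (fps_X ^ j) * lift_x (ratio_fps ^ (2 * i * j + j))"
      unfolding rhs_a_def s_def t_def x_def lift_x_ratio_fps
      by (simp add: lift_simps power_add algebra_simps)
    then have "coeff3 (rhs_a (i, j)) a b c =
        (if a = 2 * i \<and> b = j then (ratio_fps ^ (2 * i * j)) $ c else 0) +
        (if a = 2 * i + 1 \<and> b = j then (ratio_fps ^ (2 * i * j + j)) $ c else 0)"
      by (simp only: coeff3_add coeff3_lift fps_X_power_nth) auto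
    then show ?thesis
      by (cases "even a") (auto simp: R_def algebra_simps elim!: evenE oddE)
  qed
  have rhs_b: "coeff3 (rhs_b (i, j)) a b c = (if i = a div 2 \<and> j = b then 2 * br_ides_fps a b $ c else 0)"
    for i j a b c
  proof -
    \<comment> \<open>The coefficients are twice \<open>br_ides_fps\<close>, matching the factor
      \<open>1 / 2\<close> in front of the sum.\<close>
    have "rhs_b (i, j) = 2 * (lift_s (fps_X ^ (2 * i)) * lift_t (fps_X ^ j) * lift_x (ratio_fps ^ (i * j))) +
        lift_s (fps_X ^ (2 * i + 1)) * lift_t (fps_X ^ j) *
          lift_x (ratio_fps ^ (i * j) * (geom ^ j + (1 + fps_X) ^ j))"
      unfolding rhs_b_def s_def t_def x_def lift_x_ratio_fps lift_x_geom
      by (simp add: lift_simps algebra_simps)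
    then have "coeff3 (rhs_b (i, j)) a b c =
        (if a = 2 * i \<and> b = j then 2 * (ratio_fps ^ (i * j)) $ c else 0) +
        (if a = 2 * i + 1 \<and> b = j then (ratio_fps ^ (i * j) * (geom ^ j + (1 + fps_X) ^ j)) $ c else 0)"
      by (simp only: coeff3_add coeff3_double coeff3_lift fps_X_power_nth) auto
    moreover have "2 * br_ides_fps (2 * i) j $ c = 2 * (ratio_fps ^ (i * j)) $ c"
      by (simp add: br_ides_fps_def)
    moreover have "2 * br_ides_fps (2 * i + 1) j $ c = (ratio_fps ^ (i * j) * (geom ^ j + (1 + fps_X) ^ j)) $ c"
      by (simp add: br_ides_fps_def mult.left_commute[of "ratio_fps ^ (i * j)"])
    moreover have "i = a div 2 \<longleftrightarrow> a = 2 * i \<or> a = 2 * i + 1" by linarith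
    ultimately show ?thesis
      by (cases "b = j"; cases "a = 2 * i"; cases "a = 2 * i + 1") simp_all
  qed
  have R: "R k j $ 0 = 1" "R k j $ 1 = 2 * of_nat k * of_nat j" for k j
    unfolding R_def ratio_fps_power_nth by simp_all
  have z: "2 = lift_x 2" "1 = lift_x 1" by (simp_all add: lift_simps)
  have w: "2 = fps_const (2 :: rat)" "1 = fps_const (1 :: rat)" by (simp_all add: numeral_fps_const)
  have B: "br_ides_fps k j $ 1 = 1 * of_nat k * of_nat j" for k j
    using br_ides_fps_nth(2) by simp
  note a = coeff3_identity_lhs[OF lhs_a la z(1) w(1) R] and b = coeff3_identity_lhs[OF lhs_b lb z(2) w(2) br_ides_fps_nth(1) B]
  note fa = formal_sum_bidegree[of rhs_a "\<lambda>a b c. R a b $ c", OF rhs_a]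
    and fb = formal_sum_bidegree[of rhs_b "\<lambda>a b c. 2 * br_ides_fps a b $ c", OF rhs_b]
  have "1 / ((1 - s) * (1 - t)) + 2 * s * t * x / ((1 - s)\<^sup>2 * (1 - t)\<^sup>2)
        + (1 + s) ^ 3 / (8 * (1 - s)) * formal_sum lhs_a {2..} = formal_sum rhs_a UNIV"
    unfolding s_def t_def x_def by (rule coeff3_ext) (simp only: a(2) fa(2))
  moreover have "1 / ((1 - s) * (1 - t)) + s * t * x / ((1 - s)\<^sup>2 * (1 - t)\<^sup>2)
        + (1 + s) ^ 3 / (4 * (1 - s)) * formal_sum lhs_b {2..} = 1 / 2 * formal_sum rhs_b UNIV"
    unfolding s_def t_def x_def
  proof (rule coeff3_ext)
    fix a' b' c
    show "coeff3 (1 / ((1 - var_s) * (1 - var_t)) + var_s * var_t * var_x / ((1 - var_s)\<^sup>2 * (1 - var_t)\<^sup>2)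
        + (1 + var_s) ^ 3 / (4 * (1 - var_s)) * formal_sum lhs_b {2..}) a' b' c =
        coeff3 (1 / 2 * formal_sum rhs_b UNIV) a' b' c"
      using b(2)[of a' b' c] coeff3_half[of "formal_sum rhs_b UNIV" a' b' c] fb(2)[of a' b' c]
      by (simp only: mult_1)
  qed
  ultimately show ?thesis using a(1) b(1) fa(1) fb(1) by blast
qed

end
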